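(* Let $F$ be a field. For every finite dimensional Poisson algebra $U$ over $F$, the functor $\mathcal{L}(-,U)\colon\mathbf{Poiss}_F\to\mathbf{Poiss}_F$ is left adjoint to the tensor functor $U\otimes-\colon\mathbf{Poiss}_F\to\mathbf{Poiss}_F$.
   Context: All vector spaces, algebras and tensor products are over the field $F$, and algebras are associative and unital. A Poisson algebra is a vector space $P$ carrying both a commutative associative unital algebra structure and a Lie algebra structure $[\cdot,\cdot]$ such that $[p,qr]=[p,q]\,r+q\,[p,r]$ for all $p,q,r\in P$. A morphism of Poisson algebras is a linear map that is both a (unital) algebra homomorphism and a Lie algebra homomorphism. $\mathbf{Poiss}_F$ denotes the category of Poisson algebras over $F$. If $P_1,P_2$ are Poisson algebras, $P_1\otimes P_2$ is a Poisson algebra with $(p\otimes q)(r\otimes s)=pr\otimes qs$ and $[p\otimes q,r\otimes s]=pr\otimes[q,s]_{P_2}+[p,r]_{P_1}\otimes qs$; this gives the tensor functor $U\otimes-$, sending a morphism $g$ to $\mathrm{id}_U\otimes g$. For Poisson algebras $X$ and $U$ with $U$ finite dimensional, $(\mathcal{B}(X,U),\psi_{\mathcal{B}(X,U)})$ denotes the universal Poisson algebra of $X$ and $U$ (which exists): a Poisson algebra $\mathcal{B}(X,U)$ with a Poisson algebra homomorphism $\psi_{\mathcal{B}(X,U)}\colon X\to U\otimes\mathcal{B}(X,U)$ such that for every Poisson algebra $Q$ and every Poisson algebra homomorphism $f\colon X\to U\otimes Q$ there is a unique Poisson algebra homomorphism $g\colon\mathcal{B}(X,U)\to Q$ with $(\mathrm{id}_U\otimes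 g)\circ\psi_{\mathcal{B}(X,U)}=f$. The functor $\mathcal{L}(-,U)$ is defined by $\mathcal{L}(X,U)=\mathcal{B}(X,U)$ on objects; for a morphism $f\colon X\to Y$, $\mathcal{L}(f,U)=\overline{f}\colon\mathcal{B}(X,U)\to\mathcal{B}(Y,U)$ is the unique Poisson algebra homomorphism with $(\mathrm{id}_U\otimes\overline{f})\circ\psi_{\mathcal{B}(X,U)}=\psi_{\mathcal{B}(Y,U)}\circ f$. *)

theory Defs
  imports
    "HOL-Algebra.Free_Abelian_Groups"
    "Jordan_Normal_Form.Missing_VectorSpace"
begin

section \<open>Categories, functors, adjunctions\<close>

text \<open>Hom-sets need not be disjoint, so identities, composition and the arrow part of a functor
  carry the objects as arguments; \<open>Cmp C X Y Z g f\<close> is the composite of \<open>f : X \<rightarrow> Y\<close> and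
  \<open>g : Y \<rightarrow> Z\<close>.\<close>

record ('o, 'm) cat =
  Ob :: "'o set"
  Hom :: "'o \<Rightarrow> 'o \<Rightarrow> 'm set"
  Idt :: "'o \<Rightarrow> 'm"
  Cmp :: "'o \<Rightarrow> 'o \<Rightarrow> 'o \<Rightarrow> 'm \<Rightarrow> 'm \<Rightarrow> 'm"

locale category =
  fixes C :: "('o, 'm) cat"
  assumes id_hom: "X \<in> Ob C \<Longrightarrow> Idt C X \<in> Hom C X X"
    and comp_hom: "\<lbrakk>X \<in> Ob C; Y \<in> Ob C; Z \<in> Ob C; f \<in> Hom C X Y; g \<in> Hom C Y Z\<rbrakk>
        \<Longrightarrow> Cmp C X Y Z g f \<in> Hom C X Z"
    and id_left: "\<lbrakk>X \<in> Ob C; Y \<in> Ob C; f \<in> Hom C X Y\<rbrakk> \<Longrightarrow> Cmp C X Y Y (Idt C Y) f = f"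
    and id_right: "\<lbrakk>X \<in> Ob C; Y \<in> Ob C; f \<in> Hom C X Y\<rbrakk> \<Longrightarrow> Cmp C X X Y f (Idt C X) = f"
    and comp_assoc: "\<lbrakk>W \<in> Ob C; X \<in> Ob C; Y \<in> Ob C; Z \<in> Ob C;
          f \<in> Hom C W X; g \<in> Hom C X Y; h \<in> Hom C Y Z\<rbrakk>
        \<Longrightarrow> Cmp C W X Z (Cmp C X Y Z h g) f = Cmp C W Y Z h (Cmp C W X Y g f)"

locale cat_functor = C: category C + D: category D
  for C :: "('o, 'm) cat" and D :: "('p, 'n) cat" +
  fixes Fo :: "'o \<Rightarrow> 'p" and Fa :: "'o \<Rightarrow> 'o \<Rightarrow> 'm \<Rightarrow> 'n"
  assumes obj: "X \<in> Ob C \<Longrightarrow> Fo X \<in> Ob D"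
    and arr: "\<lbrakk>X \<in> Ob C; Y \<in> Ob C; f \<in> Hom C X Y\<rbrakk> \<Longrightarrow> Fa X Y f \<in> Hom D (Fo X) (Fo Y)"
    and arr_id: "X \<in> Ob C \<Longrightarrow> Fa X X (Idt C X) = Idt D (Fo X)"
    and arr_comp: "\<lbrakk>X \<in> Ob C; Y \<in> Ob C; Z \<in> Ob C; f \<in> Hom C X Y; g \<in> Hom C Y Z\<rbrakk>
        \<Longrightarrow> Fa X Z (Cmp C X Y Z g f) = Cmp D (Fo X) (Fo Y) (Fo Z) (Fa Y Z g) (Fa X Y f)"

definition left_adjoint ::
  "('o, 'm) cat \<Rightarrow> ('p, 'n) cat \<Rightarrow> ('o \<Rightarrow> 'p) \<Rightarrow> ('o \<Rightarrow> 'o \<Rightarrow> 'm \<Rightarrow> 'n)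
    \<Rightarrow> ('p \<Rightarrow> 'o) \<Rightarrow> ('p \<Rightarrow> 'p \<Rightarrow> 'n \<Rightarrow> 'm) \<Rightarrow> bool" where
  "left_adjoint C D Fo Fa Go Ga \<longleftrightarrow>
     cat_functor C D Fo Fa \<and> cat_functor D C Go Ga \<and>
     (\<exists>\<Phi>. (\<forall>X\<in>Ob C. \<forall>Y\<in>Ob D. bij_betw (\<Phi> X Y) (Hom D (Fo X) Y) (Hom C X (Go Y)))
        \<and> (\<forall>X\<in>Ob C. \<forall>X'\<in>Ob C. \<forall>Y\<in>Ob D. \<forall>f\<in>Hom C X' X. \<forall>h\<in>Hom D (Fo X) Y.
              \<Phi> X' Y (Cmp D (Fo X') (Fo X) Y h (Fa X' X f)) = Cmp C X' X (Go Y) (\<Phi> X Y h) f)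
        \<and> (\<forall>X\<in>Ob C. \<forall>Y\<in>Ob D. \<forall>Y'\<in>Ob D. \<forall>k\<in>Hom D Y Y'. \<forall>h\<in>Hom D (Fo X) Y.
              \<Phi> X Y' (Cmp D (Fo X) Y Y' k h) = Cmp C X (Go Y) (Go Y') (Ga Y Y' k) (\<Phi> X Y h)))"


section \<open>Poisson algebras\<close>

record ('k, 'a) poisson = "('k, 'a) module" +
  lie :: "'a \<Rightarrow> 'a \<Rightarrow> 'a"

text \<open>The locale \<^locale>\<open>algebra\<close> is that of commutative, associative, unital algebras;
  the zero algebra is included.\<close>

locale poisson_algebra = algebra F P
  for F :: "('k, 'f) ring_scheme" (structure) and P :: "('k, 'a, 'm) poisson_scheme" (structure) +
  assumes lie_closed: "\<lbrakk>x \<in> carrier P; y \<in> carrier P\<rbrakk> \<Longrightarrow> lie P x y \<in> carrier P"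
    and lie_add_left: "\<lbrakk>x \<in> carrier P; y \<in> carrier P; z \<in> carrier P\<rbrakk>
        \<Longrightarrow> lie P (x \<oplus>\<^bsub>P\<^esub> y) z = lie P x z \<oplus>\<^bsub>P\<^esub> lie P y z"
    and lie_add_right: "\<lbrakk>x \<in> carrier P; y \<in> carrier P; z \<in> carrier P\<rbrakk>
        \<Longrightarrow> lie P x (y \<oplus>\<^bsub>P\<^esub> z) = lie P x y \<oplus>\<^bsub>P\<^esub> lie P x z"
    and lie_smult_left: "\<lbrakk>c \<in> carrier F; x \<in> carrier P; y \<in> carrier P\<rbrakk>
        \<Longrightarrow> lie P (c \<odot>\<^bsub>P\<^esub> x) y = c \<odot>\<^bsub>P\<^esub> lie P x y"
    and lie_smult_right: "\<lbrakk>c \<in> carrier F; x \<in> carrier P; y \<in> carrier P\<rbrakk>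
        \<Longrightarrow> lie P x (c \<odot>\<^bsub>P\<^esub> y) = c \<odot>\<^bsub>P\<^esub> lie P x y"
    and lie_alternating: "x \<in> carrier P \<Longrightarrow> lie P x x = \<zero>\<^bsub>P\<^esub>"
    and lie_jacobi: "\<lbrakk>x \<in> carrier P; y \<in> carrier P; z \<in> carrier P\<rbrakk>
        \<Longrightarrow> lie P x (lie P y z) \<oplus>\<^bsub>P\<^esub> lie P y (lie P z x) \<oplus>\<^bsub>P\<^esub> lie P z (lie P x y) = \<zero>\<^bsub>P\<^esub>"
    and lie_leibniz: "\<lbrakk>p \<in> carrier P; q \<in> carrier P; r \<in> carrier P\<rbrakk>
        \<Longrightarrow> lie P p (q \<otimes>\<^bsub>P\<^esub> r) = lie P p q \<otimes>\<^bsub>P\<^esub> r \<oplus>\<^bsub>P\<^esub> q \<otimes>\<^bsub>P\<^esub> lie P p r"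

text \<open>Morphisms are extensional functions, so that equality of morphisms is equality on the
  carrier.\<close>

definition poisson_hom :: "'k ring \<Rightarrow> ('k, 'a) poisson \<Rightarrow> ('k, 'b) poisson \<Rightarrow> ('a \<Rightarrow> 'b) set" where
  "poisson_hom F P Q =
     {h \<in> extensional (carrier P). h \<in> module_hom F P Q \<and> h \<in> ring_hom P Q \<and>
        (\<forall>x\<in>carrier P. \<forall>y\<in>carrier P. h (lie P x y) = lie Q (h x) (h y))}"

text \<open>The type \<open>'a\<close> plays the role of the universe: the objects are the Poisson algebras whose
  carrier is a subset of \<open>'a\<close>.\<close>

definition Poiss :: "'k ring \<Rightarrow> (('k, 'a) poisson, 'a \<Rightarrow> 'a) cat" where
  "Poiss F =
     \<lparr>Ob = {P. poisson_algebra F P},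
      Hom = poisson_hom F,
      Idt = (\<lambda>P. \<lambda>x\<in>carrier P. x),
      Cmp = (\<lambda>X Y Z g f. compose (carrier X) g f)\<rparr>"


section \<open>Tensor products\<close>

text \<open>\<open>U \<otimes> Q\<close> is the free abelian group on \<open>U \<times> Q\<close> modulo the balanced bilinear relations;
  \<open>frag_of (u, q)\<close> represents \<open>u \<otimes> q\<close>. Products, scalar multiples, brackets and \<open>id \<otimes> g\<close> are the
  (bi)additive extensions of the formulas on generators, computed on representatives; they respect
  the relations, so the chosen representative does not matter.\<close>

definition tensor_free ::
  "('k, 'u) poisson \<Rightarrow> ('k, 'q) poisson \<Rightarrow> ('u \<times> 'q \<Rightarrow>\<^sub>0 int) monoid" where
  "tensor_free U Q = free_Abelian_group (carrier U \<times> carrier Q)"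

definition tensor_rel ::
  "'k ring \<Rightarrow> ('k, 'u) poisson \<Rightarrow> ('k, 'q) poisson \<Rightarrow> ('u \<times> 'q \<Rightarrow>\<^sub>0 int) set" where
  "tensor_rel F U Q = generate (tensor_free U Q)
     ({frag_of (u \<oplus>\<^bsub>U\<^esub> v, q) - frag_of (u, q) - frag_of (v, q) | u v q.
         u \<in> carrier U \<and> v \<in> carrier U \<and> q \<in> carrier Q} \<union>
      {frag_of (u, q \<oplus>\<^bsub>Q\<^esub> r) - frag_of (u, q) - frag_of (u, r) | u q r.
         u \<in> carrier U \<and> q \<in> carrier Q \<and> r \<in> carrier Q} \<union>
      {frag_of (c \<odot>\<^bsub>U\<^esub> u, q) - frag_of (u, c \<odot>\<^bsub>Q\<^esub> q) | c u q.
         c \<in> carrier F \<and> u \<in> carrier U \<and> q \<in> carrier Q})"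

definition tensor_class ::
  "'k ring \<Rightarrow> ('k, 'u) poisson \<Rightarrow> ('k, 'q) poisson
    \<Rightarrow> ('u \<times> 'q \<Rightarrow>\<^sub>0 int) \<Rightarrow> ('u \<times> 'q \<Rightarrow>\<^sub>0 int) set" where
  "tensor_class F U Q x = tensor_rel F U Q #>\<^bsub>tensor_free U Q\<^esub> x"

definition some_rep :: "'b set \<Rightarrow> 'b" where
  "some_rep A = (SOME x. x \<in> A)"

definition frag_bilinear ::
  "('b \<Rightarrow> 'b \<Rightarrow> 'b \<Rightarrow>\<^sub>0 int) \<Rightarrow> ('b \<Rightarrow>\<^sub>0 int) \<Rightarrow> ('b \<Rightarrow>\<^sub>0 int) \<Rightarrow> ('b \<Rightarrow>\<^sub>0 int)" where
  "frag_bilinear b x y = frag_extend (\<lambda>s. frag_extend (b s) y) x"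

definition poisson_tensor ::
  "'k ring \<Rightarrow> ('k, 'u) poisson \<Rightarrow> ('k, 'q) poisson \<Rightarrow> ('k, ('u \<times> 'q \<Rightarrow>\<^sub>0 int) set) poisson" where
  "poisson_tensor F U Q =
     \<lparr>carrier = carrier (tensor_free U Q Mod tensor_rel F U Q),
      mult = (\<lambda>A B. tensor_class F U Q
        (frag_bilinear (\<lambda>(p, q) (r, s). frag_of (p \<otimes>\<^bsub>U\<^esub> r, q \<otimes>\<^bsub>Q\<^esub> s))
          (some_rep A) (some_rep B))),
      one = tensor_class F U Q (frag_of (\<one>\<^bsub>U\<^esub>, \<one>\<^bsub>Q\<^esub>)),
      zero = \<one>\<^bsub>tensor_free U Q Mod tensor_rel F U Q\<^esub>,
      add = (\<lambda>A B. A \<otimes>\<^bsub>tensor_free U Q Mod tensor_rel F U Q\<^esub> B),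
      smult = (\<lambda>c A. tensor_class F U Q
        (frag_extend (\<lambda>(p, q). frag_of (c \<odot>\<^bsub>U\<^esub> p, q)) (some_rep A))),
      lie = (\<lambda>A B. tensor_class F U Q
        (frag_bilinear
          (\<lambda>(p, q) (r, s). frag_of (p \<otimes>\<^bsub>U\<^esub> r, lie Q q s) + frag_of (lie U p r, q \<otimes>\<^bsub>Q\<^esub> s))
          (some_rep A) (some_rep B)))\<rparr>"

text \<open>The linear map \<open>id \<otimes> g : U \<otimes> Q \<rightarrow> U \<otimes> Q'\<close>.\<close>

definition id_tensor ::
  "'k ring \<Rightarrow> ('k, 'u) poisson \<Rightarrow> ('k, 'q) poisson \<Rightarrow> ('q \<Rightarrow> 'q)
    \<Rightarrow> ('u \<times> 'q \<Rightarrow>\<^sub>0 int) set \<Rightarrow> ('u \<times> 'q \<Rightarrow>\<^sub>0 int) set" where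
  "id_tensor F U Q' g A =
     tensor_class F U Q' (frag_extend (\<lambda>(u, q). frag_of (u, g q)) (some_rep A))"

text \<open>To make \<open>U \<otimes> -\<close> an endofunctor of \<^const>\<open>Poiss\<close>, the carrier of \<open>U \<otimes> Q\<close> is copied into the
  universe type \<open>'a\<close> along a chosen injection. One exists whenever \<open>'a\<close> is infinite and \<open>U\<close> is
  finite dimensional: if \<open>U\<close> is spanned by \<open>n\<close> elements, \<open>U \<otimes> Q\<close> is an image of \<open>Q^n\<close>.\<close>

definition transport :: "('b \<Rightarrow> 'a) \<Rightarrow> ('k, 'b) poisson \<Rightarrow> ('k, 'a) poisson" where
  "transport h P = (let d = inv_into (carrier P) h in
     \<lparr>carrier = h ` carrier P,
      mult = (\<lambda>x y. h (d x \<otimes>\<^bsub>P\<^esub> d y)),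
      one = h \<one>\<^bsub>P\<^esub>,
      zero = h \<zero>\<^bsub>P\<^esub>,
      add = (\<lambda>x y. h (d x \<oplus>\<^bsub>P\<^esub> d y)),
      smult = (\<lambda>c x. h (c \<odot>\<^bsub>P\<^esub> d x)),
      lie = (\<lambda>x y. h (lie P (d x) (d y)))\<rparr>)"

definition tensor_enc ::
  "'k ring \<Rightarrow> ('k, 'u) poisson \<Rightarrow> ('k, 'a) poisson \<Rightarrow> ('u \<times> 'a \<Rightarrow>\<^sub>0 int) set \<Rightarrow> 'a" where
  "tensor_enc F U Q = (SOME h. inj_on h (carrier (poisson_tensor F U Q)))"

definition tensor_obj ::
  "'k ring \<Rightarrow> ('k, 'u) poisson \<Rightarrow> ('k, 'a) poisson \<Rightarrow> ('k, 'a) poisson" where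
  "tensor_obj F U Q = transport (tensor_enc F U Q) (poisson_tensor F U Q)"

definition tensor_arr ::
  "'k ring \<Rightarrow> ('k, 'u) poisson \<Rightarrow> ('k, 'a) poisson \<Rightarrow> ('k, 'a) poisson \<Rightarrow> ('a \<Rightarrow> 'a) \<Rightarrow> 'a \<Rightarrow> 'a" where
  "tensor_arr F U Q Q' g = (\<lambda>x\<in>carrier (tensor_obj F U Q).
     tensor_enc F U Q' (id_tensor F U Q' g
       (inv_into (carrier (poisson_tensor F U Q)) (tensor_enc F U Q) x)))"


section \<open>Universal Poisson algebras\<close>

definition is_universal_poisson ::
  "'k ring \<Rightarrow> ('k, 'u) poisson \<Rightarrow> ('k, 'a) poisson \<Rightarrow> ('k, 'a) poisson \<Rightarrow> ('a \<Rightarrow> 'a) \<Rightarrow> bool" where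
  "is_universal_poisson F U X B \<psi> \<longleftrightarrow>
     poisson_algebra F B \<and> \<psi> \<in> poisson_hom F X (tensor_obj F U B) \<and>
     (\<forall>Q f. poisson_algebra F Q \<longrightarrow> f \<in> poisson_hom F X (tensor_obj F U Q) \<longrightarrow>
        (\<exists>!g. g \<in> poisson_hom F B Q \<and> compose (carrier X) (tensor_arr F U B Q g) \<psi> = f))"

text \<open>Arrow part of \<open>\<L>(-, U)\<close>, for a choice \<open>(B X, \<psi> X)\<close> of universal Poisson algebras.\<close>

definition L_arr ::
  "'k ring \<Rightarrow> ('k, 'u) poisson \<Rightarrow> (('k, 'a) poisson \<Rightarrow> ('k, 'a) poisson)
    \<Rightarrow> (('k, 'a) poisson \<Rightarrow> 'a \<Rightarrow> 'a)
    \<Rightarrow> ('k, 'a) poisson \<Rightarrow> ('k, 'a) poisson \<Rightarrow> ('a \<Rightarrow> 'a) \<Rightarrow> 'a \<Rightarrow> 'a" where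
  "L_arr F U B \<psi> X Y f = (THE g. g \<in> poisson_hom F (B X) (B Y) \<and>
     compose (carrier X) (tensor_arr F U (B X) (B Y) g) (\<psi> X) = compose (carrier X) (\<psi> Y) f)"

end

theory Submission
  imports Defs
begin

text \<open>
  The category-theoretic half of the statement is formal. The universal property says that
  \<open>\<psi> X : X \<rightarrow> U \<otimes> B X\<close> is a universal arrow from \<open>X\<close> to the functor \<open>U \<otimes> -\<close>, and a functor that has a
  universal arrow from every object has a left adjoint: send \<open>h : B X \<rightarrow> Y\<close> to \<open>(id \<otimes> h) \<circ> \<psi> X\<close>. This is
  \<open>left_adjoint_of_universal_arrows\<close>; functoriality of the left adjoint comes from uniqueness.

  The substance is that \<open>U \<otimes> -\<close> is a functor on Poisson algebras at all. The elements of \<open>U \<otimes> Q\<close> are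
  classes of formal integer combinations of pairs \<open>(u, q)\<close> modulo the subgroup \<open>R\<close> of bilinear and
  balanced relations. Product, bracket and scalar multiplication are lifted to biadditive (additive)
  operations \<open>mul\<close>, \<open>bra\<close>, \<open>scl\<close> on the combinations themselves. Each axiom except \<open>[x, x] = 0\<close>
  then says that a certain multiadditive expression takes values in \<open>R\<close>, and for that it is enough to
  look at pairs (\<open>frag_additive_in\<close> and its analogues), where the axiom becomes an identity in \<open>U\<close> and
  \<open>Q\<close>; the exception reduces to pairs by skew symmetry. The longest case is the Jacobi identity: by
  Leibniz, \<open>[x, [y, z]]\<close> splits into six tensors, two of which cancel in the cyclic sum by the Jacobi
  identities of \<open>Q\<close> and \<open>U\<close>, the others in pairs by skew symmetry.

  Since \<open>U \<otimes> Q\<close> is copied into the universe along a chosen injection, all this is stated for an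
  arbitrary surjection \<open>c\<close> from the combinations onto a structure \<open>P\<close> with the right kernel and
  operations (locale \<open>tensor_presentation\<close>), which covers the tensor product and its copy at once.
  The injection exists because, for a finite spanning set \<open>A\<close> of \<open>U\<close>, every element of \<open>U \<otimes> Q\<close> is
  \<open>\<Sum>e\<in>A. e \<otimes> f e\<close> for some \<open>f : A \<rightarrow> Q\<close>; so \<open>U \<otimes> Q\<close> is an image of a set of lists over the universe,
  and there are no more lists over an infinite set than elements of it (\<open>ex_inj_tensor\<close>).
\<close>

section \<open>Adjunctions from universal arrows\<close>

text \<open>Here \<open>\<eta> X\<close> is a universal arrow from \<open>X\<close> to the functor \<open>G\<close>. The bijection is
  \<open>h \<mapsto> G h \<circ> \<eta> X\<close>; the equation assumed of \<open>Fa\<close> is naturality of \<open>\<eta>\<close>, and it already makes \<open>Fa\<close>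
  functorial, because both sides of each functor law have the same image under this injection.\<close>

lemma left_adjoint_of_universal_arrows:
  assumes C: "category C"
    and G: "cat_functor D C Go Ga"
    and Fo: "\<And>X. X \<in> Ob C \<Longrightarrow> Fo X \<in> Ob D"
    and unit: "\<And>X. X \<in> Ob C \<Longrightarrow> \<eta> X \<in> Hom C X (Go (Fo X))"
    and universal: "\<And>X Y f. \<lbrakk>X \<in> Ob C; Y \<in> Ob D; f \<in> Hom C X (Go Y)\<rbrakk> \<Longrightarrow>
          \<exists>!g. g \<in> Hom D (Fo X) Y \<and> Cmp C X (Go (Fo X)) (Go Y) (Ga (Fo X) Y g) (\<eta> X) = f"
    and Fa: "\<And>X Y f. \<lbrakk>X \<in> Ob C; Y \<in> Ob C; f \<in> Hom C X Y\<rbrakk> \<Longrightarrow>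
          Fa X Y f \<in> Hom D (Fo X) (Fo Y) \<and>
          Cmp C X (Go (Fo X)) (Go (Fo Y)) (Ga (Fo X) (Fo Y) (Fa X Y f)) (\<eta> X)
            = Cmp C X Y (Go (Fo Y)) (\<eta> Y) f"
  shows "left_adjoint C D Fo Fa Go Ga"
proof -
  interpret C: category C by (rule C)
  interpret D: category D using G by (rule cat_functor.axioms)
  interpret G: cat_functor D C Go Ga by (rule G)
  note mem = Fo unit G.obj G.arr C.comp_hom D.comp_hom
  define \<Phi> where "\<Phi> X Y h = Cmp C X (Go (Fo X)) (Go Y) (Ga (Fo X) Y h) (\<eta> X)" for X Y h
  have \<Phi>_hom: "\<Phi> X Y h \<in> Hom C X (Go Y)"
    if "X \<in> Ob C" "Y \<in> Ob D" "h \<in> Hom D (Fo X) Y" for X Y h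
    unfolding \<Phi>_def using that by (blast intro: mem)
  have \<Phi>_inj: "g = h" if "X \<in> Ob C" "Y \<in> Ob D" "g \<in> Hom D (Fo X) Y" "h \<in> Hom D (Fo X) Y"
    "\<Phi> X Y g = \<Phi> X Y h" for X Y g h
    using universal[OF that(1,2) \<Phi>_hom[OF that(1,2,4)]] that(3-5) unfolding \<Phi>_def by blast
  have \<Phi>_Fa: "\<Phi> X (Fo Y) (Fa X Y f) = Cmp C X Y (Go (Fo Y)) (\<eta> Y) f"
    and Fa_hom: "Fa X Y f \<in> Hom D (Fo X) (Fo Y)"
    if "X \<in> Ob C" "Y \<in> Ob C" "f \<in> Hom C X Y" for X Y f
    using Fa[OF that] by (auto simp: \<Phi>_def)
  have nat_right: "\<Phi> X Y' (Cmp D (Fo X) Y Y' k h) = Cmp C X (Go Y) (Go Y') (Ga Y Y' k) (\<Phi> X Y h)"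
    if "X \<in> Ob C" "Y \<in> Ob D" "Y' \<in> Ob D" "k \<in> Hom D Y Y'" "h \<in> Hom D (Fo X) Y" for X Y Y' k h
    unfolding \<Phi>_def using that
    by (simp add: G.arr_comp[OF Fo that(2,3,5,4)]
        C.comp_assoc[OF _ G.obj G.obj G.obj unit G.arr G.arr] Fo)
  have nat_left: "\<Phi> X' Y (Cmp D (Fo X') (Fo X) Y h (Fa X' X f)) = Cmp C X' X (Go Y) (\<Phi> X Y h) f"
    if "X \<in> Ob C" "X' \<in> Ob C" "Y \<in> Ob D" "f \<in> Hom C X' X" "h \<in> Hom D (Fo X) Y" for X X' Y f h
  proof -
    have "\<Phi> X' Y (Cmp D (Fo X') (Fo X) Y h (Fa X' X f))
        = Cmp C X' (Go (Fo X)) (Go Y) (Ga (Fo X) Y h) (Cmp C X' X (Go (Fo X)) (\<eta> X) f)"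
      using that by (simp add: nat_right Fo Fa_hom \<Phi>_Fa)
    also have "\<dots> = Cmp C X' X (Go Y) (\<Phi> X Y h) f"
      unfolding \<Phi>_def using that by (simp add: C.comp_assoc[OF _ _ _ _ _ unit G.arr] G.obj Fo)
    finally show ?thesis .
  qed
  have "bij_betw (\<Phi> X Y) (Hom D (Fo X) Y) (Hom C X (Go Y))" if X: "X \<in> Ob C" and Y: "Y \<in> Ob D" for X Y
    unfolding bij_betw_def
  proof
    show "inj_on (\<Phi> X Y) (Hom D (Fo X) Y)"
      using \<Phi>_inj[OF X Y] by (auto intro: inj_onI)
    show "\<Phi> X Y ` Hom D (Fo X) Y = Hom C X (Go Y)"
    proof
      show "\<Phi> X Y ` Hom D (Fo X) Y \<subseteq> Hom C X (Go Y)"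
        using \<Phi>_hom[OF X Y] by blast
      show "Hom C X (Go Y) \<subseteq> \<Phi> X Y ` Hom D (Fo X) Y"
      proof
        fix f assume "f \<in> Hom C X (Go Y)"
        from ex1_implies_ex[OF universal[OF X Y this]]
        show "f \<in> \<Phi> X Y ` Hom D (Fo X) Y" unfolding \<Phi>_def by blast
      qed
    qed
  qed
  moreover have "cat_functor C D Fo Fa"
  proof
    fix X Y f assume "X \<in> Ob C" "Y \<in> Ob C" "f \<in> Hom C X Y"
    then show "Fa X Y f \<in> Hom D (Fo X) (Fo Y)" by (rule Fa_hom)
  next
    fix X assume X: "X \<in> Ob C"
    have "\<Phi> X (Fo X) (Idt D (Fo X)) = \<Phi> X (Fo X) (Fa X X (Idt C X))"
      using X by (simp add: \<Phi>_Fa C.id_hom C.id_right[OF _ G.obj unit] Fo)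
        (simp add: \<Phi>_def G.arr_id Fo C.id_left[OF _ G.obj unit])
    then show "Fa X X (Idt C X) = Idt D (Fo X)"
      using X by (intro \<Phi>_inj[of X "Fo X"]) (auto intro: Fo Fa_hom C.id_hom D.id_hom)
  next
    fix X Y Z f g
    assume XYZ: "X \<in> Ob C" "Y \<in> Ob C" "Z \<in> Ob C" and fg: "f \<in> Hom C X Y" "g \<in> Hom C Y Z"
    have "\<Phi> X (Fo Z) (Cmp D (Fo X) (Fo Y) (Fo Z) (Fa Y Z g) (Fa X Y f))
        = Cmp C X Y (Go (Fo Z)) (Cmp C Y Z (Go (Fo Z)) (\<eta> Z) g) f"
      using XYZ fg by (simp add: nat_left Fo Fa_hom \<Phi>_Fa)
    also have "\<dots> = \<Phi> X (Fo Z) (Fa X Z (Cmp C X Y Z g f))"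
      using XYZ fg by (simp add: \<Phi>_Fa C.comp_hom[of X Y Z] C.comp_assoc[of X Y Z] G.obj Fo unit)
    finally show "Fa X Z (Cmp C X Y Z g f) = Cmp D (Fo X) (Fo Y) (Fo Z) (Fa Y Z g) (Fa X Y f)"
      using XYZ fg by (intro \<Phi>_inj[of X "Fo Z"]) (auto intro: Fo Fa_hom C.comp_hom D.comp_hom[of _ "Fo Y"])
  qed (rule Fo)
  ultimately show ?thesis
    unfolding left_adjoint_def using G nat_left nat_right by (intro conjI exI[of _ \<Phi>]) auto
qed

section \<open>Multiadditive maps on free abelian groups\<close>

lemma frag_extend_diff_fun:
  fixes f g :: "'b \<Rightarrow> 'a \<Rightarrow>\<^sub>0 int"
  shows "frag_extend (\<lambda>s. f s - g s) x = frag_extend f x - frag_extend g x"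
proof -
  have "frag_cmul k (a - b) = frag_cmul k a - frag_cmul k b" for k and a b :: "'a \<Rightarrow>\<^sub>0 int"
    by (rule poly_mapping_eqI) (simp add: lookup_minus algebra_simps)
  then show ?thesis
    by (simp add: frag_extend_def sum_subtractf)
qed

lemma frag_bilinear_diff_left: "frag_bilinear b (x - x') y = frag_bilinear b x y - frag_bilinear b x' y"
  by (simp add: frag_bilinear_def frag_extend_diff)

lemma frag_bilinear_diff_right: "frag_bilinear b x (y - y') = frag_bilinear b x y - frag_bilinear b x y'"
  by (simp add: frag_bilinear_def frag_extend_diff frag_extend_diff_fun)

lemma frag_bilinear_add_left: "frag_bilinear b (x + x') y = frag_bilinear b x y + frag_bilinear b x' y"
  by (simp add: frag_bilinear_def frag_extend_add)

lemma frag_bilinear_add_right: "frag_bilinear b x (y + y') = frag_bilinear b x y + frag_bilinear b x y'"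
  using frag_bilinear_diff_right[of b x "y + y'" y'] by (simp add: algebra_simps)

lemma frag_bilinear_of [simp]: "frag_bilinear b (frag_of s) (frag_of t) = b s t"
  by (simp add: frag_bilinear_def)

lemma keys_frag_diff_subset:
  "Poly_Mapping.keys x \<subseteq> S \<Longrightarrow> Poly_Mapping.keys y \<subseteq> S \<Longrightarrow> Poly_Mapping.keys (x - y) \<subseteq> S"
  using keys_diff[of x y] by blast

lemma keys_frag_add_subset:
  fixes x y :: "'a \<Rightarrow>\<^sub>0 int"
  shows "Poly_Mapping.keys x \<subseteq> S \<Longrightarrow> Poly_Mapping.keys y \<subseteq> S \<Longrightarrow> Poly_Mapping.keys (x + y) \<subseteq> S"
  using keys_add[of x y] by blast

text \<open>An additive map sends a free abelian group into a subgroup \<open>H\<close> as soon as it sends the generators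
  there. Identities between additive maps are the case \<open>H = {0}\<close>, congruences modulo \<open>R\<close> the case
  \<open>H = R\<close>. Subgroups are described by closure under subtraction, which matches the induction principle
  of free abelian groups.\<close>

lemma frag_additive_in:
  fixes T :: "('a \<Rightarrow>\<^sub>0 int) \<Rightarrow> ('b \<Rightarrow>\<^sub>0 int)"
  assumes H: "0 \<in> H" "\<And>a b. a \<in> H \<Longrightarrow> b \<in> H \<Longrightarrow> a - b \<in> H"
    and T: "\<And>x x'. T (x - x') = T x - T x'"
    and gen: "\<And>s. s \<in> S \<Longrightarrow> T (frag_of s) \<in> H"
    and x: "Poly_Mapping.keys x \<subseteq> S"
  shows "T x \<in> H"
  using x
proof (rule free_Abelian_group_induct)
  have "T 0 = 0" using T[of 0 0] by simp
  then show "T 0 \<in> H" using H(1) by simp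
qed (simp_all add: T H gen)

lemma frag_biadditive_in:
  fixes T :: "('a \<Rightarrow>\<^sub>0 int) \<Rightarrow> ('c \<Rightarrow>\<^sub>0 int) \<Rightarrow> ('b \<Rightarrow>\<^sub>0 int)"
  assumes H: "0 \<in> H" "\<And>a b. a \<in> H \<Longrightarrow> b \<in> H \<Longrightarrow> a - b \<in> H"
    and T: "\<And>x x' y. T (x - x') y = T x y - T x' y" "\<And>x y y'. T x (y - y') = T x y - T x y'"
    and gen: "\<And>s t. s \<in> S \<Longrightarrow> t \<in> S' \<Longrightarrow> T (frag_of s) (frag_of t) \<in> H"
    and x: "Poly_Mapping.keys x \<subseteq> S" and y: "Poly_Mapping.keys y \<subseteq> S'"
  shows "T x y \<in> H"
proof (rule frag_additive_in[where T = "\<lambda>x. T x y", OF H(1) _ _ _ x])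
  fix s assume "s \<in> S"
  then show "T (frag_of s) y \<in> H"
    by (intro frag_additive_in[where T = "T (frag_of s)", OF H _ _ y] T gen)
qed (simp_all add: H(2) T)

lemma frag_triadditive_in:
  fixes T :: "('a \<Rightarrow>\<^sub>0 int) \<Rightarrow> ('c \<Rightarrow>\<^sub>0 int) \<Rightarrow> ('d \<Rightarrow>\<^sub>0 int) \<Rightarrow> ('b \<Rightarrow>\<^sub>0 int)"
  assumes H: "0 \<in> H" "\<And>a b. a \<in> H \<Longrightarrow> b \<in> H \<Longrightarrow> a - b \<in> H"
    and T: "\<And>x x' y z. T (x - x') y z = T x y z - T x' y z"
      "\<And>x y y' z. T x (y - y') z = T x y z - T x y' z"
      "\<And>x y z z'. T x y (z - z') = T x y z - T x y z'"
    and gen: "\<And>s t u. s \<in> S \<Longrightarrow> t \<in> S' \<Longrightarrow> u \<in> S'' \<Longrightarrow> T (frag_of s) (frag_of t) (frag_of u) \<in> H"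
    and x: "Poly_Mapping.keys x \<subseteq> S" and y: "Poly_Mapping.keys y \<subseteq> S'" and z: "Poly_Mapping.keys z \<subseteq> S''"
  shows "T x y z \<in> H"
proof (rule frag_additive_in[where T = "\<lambda>x. T x y z", OF H(1) _ _ _ x])
  fix s assume "s \<in> S"
  then show "T (frag_of s) y z \<in> H"
    by (intro frag_biadditive_in[where T = "T (frag_of s)", OF H _ _ _ y z] T gen)
qed (simp_all add: H(2) T)

section \<open>Poisson operations on representatives\<close>

context poisson_algebra
begin

text \<open>The multiplicative laws of \<open>P\<close> get names of their own because the base field \<open>F\<close>, also a
  commutative ring, competes for the usual ones.\<close>

lemmas mult_closed = cring.cring_simprules(5)[OF M_cring]
  and mult_assoc = cring.cring_simprules(11)[OF M_cring]
  and mult_one_left = cring.cring_simprules(12)[OF M_cring]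
  and mult_distrib_left = cring.cring_simprules(13)[OF M_cring]
  and mult_commute = cring.cring_simprules(14)[OF M_cring]
  and mult_left_commute = cring.cring_simprules(24)[OF M_cring]
  and mult_distrib_right = cring.cring_simprules(25)[OF M_cring]
  and mult_zero_right = cring.cring_simprules(27)[OF M_cring]

text \<open>Polarise \<open>[x + y, x + y] = 0\<close>.\<close>

lemma lie_skew:
  assumes x: "x \<in> carrier P" and y: "y \<in> carrier P"
  shows "lie P x y \<oplus>\<^bsub>P\<^esub> lie P y x = \<zero>\<^bsub>P\<^esub>"
proof -
  have "\<zero>\<^bsub>P\<^esub> = lie P (x \<oplus>\<^bsub>P\<^esub> y) (x \<oplus>\<^bsub>P\<^esub> y)"
    using x y by (simp add: lie_alternating)
  also have "\<dots> = lie P x y \<oplus>\<^bsub>P\<^esub> lie P y x"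
    using x y by (simp add: lie_add_left lie_add_right lie_closed lie_alternating[OF x] lie_alternating[OF y]
        M.add.m_comm)
  finally show ?thesis ..
qed

end

locale poisson_pair = U: poisson_algebra F U + Q: poisson_algebra F Q
  for F :: "'k ring" and U :: "('k, 'u) poisson" and Q :: "('k, 'q) poisson"
begin

lemmas U_closed = U.mult_closed U.lie_closed U.smult_closed
  and Q_closed = Q.mult_closed Q.lie_closed Q.smult_closed

text \<open>The formal combinations of pairs: the group of which \<open>U \<otimes> Q\<close> is a quotient.\<close>

definition G :: "('u \<times> 'q \<Rightarrow>\<^sub>0 int) set" where
  "G = carrier (tensor_free U Q)"

abbreviation R :: "('u \<times> 'q \<Rightarrow>\<^sub>0 int) set" where
  "R \<equiv> tensor_rel F U Q"

definition mul :: "('u \<times> 'q \<Rightarrow>\<^sub>0 int) \<Rightarrow> ('u \<times> 'q \<Rightarrow>\<^sub>0 int) \<Rightarrow> ('u \<times> 'q \<Rightarrow>\<^sub>0 int)" where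
  "mul = frag_bilinear (\<lambda>(p, q) (r, s). frag_of (p \<otimes>\<^bsub>U\<^esub> r, q \<otimes>\<^bsub>Q\<^esub> s))"

definition bra :: "('u \<times> 'q \<Rightarrow>\<^sub>0 int) \<Rightarrow> ('u \<times> 'q \<Rightarrow>\<^sub>0 int) \<Rightarrow> ('u \<times> 'q \<Rightarrow>\<^sub>0 int)" where
  "bra = frag_bilinear
     (\<lambda>(p, q) (r, s). frag_of (p \<otimes>\<^bsub>U\<^esub> r, lie Q q s) + frag_of (lie U p r, q \<otimes>\<^bsub>Q\<^esub> s))"

definition scl :: "'k \<Rightarrow> ('u \<times> 'q \<Rightarrow>\<^sub>0 int) \<Rightarrow> ('u \<times> 'q \<Rightarrow>\<^sub>0 int)" where
  "scl c = frag_extend (\<lambda>(p, q). frag_of (c \<odot>\<^bsub>U\<^esub> p, q))"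

lemma G_iff: "x \<in> G \<longleftrightarrow> Poly_Mapping.keys x \<subseteq> carrier U \<times> carrier Q"
  by (simp add: G_def tensor_free_def)

lemma additive:
  "mul (x - x') y = mul x y - mul x' y" "mul x (y - y') = mul x y - mul x y'"
  "bra (x - x') y = bra x y - bra x' y" "bra x (y - y') = bra x y - bra x y'"
  "scl c (x - x') = scl c x - scl c x'"
  "mul (x + x') y = mul x y + mul x' y" "mul x (y + y') = mul x y + mul x y'"
  "bra (x + x') y = bra x y + bra x' y" "bra x (y + y') = bra x y + bra x y'"
  "scl c (x + x') = scl c x + scl c x'"
  by (simp_all add: mul_def bra_def scl_def frag_extend_diff frag_extend_add frag_bilinear_diff_left
      frag_bilinear_diff_right frag_bilinear_add_left frag_bilinear_add_right)

lemma on_generators [simp]: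
  "mul (frag_of (p, q)) (frag_of (r, s)) = frag_of (p \<otimes>\<^bsub>U\<^esub> r, q \<otimes>\<^bsub>Q\<^esub> s)"
  "bra (frag_of (p, q)) (frag_of (r, s))
     = frag_of (p \<otimes>\<^bsub>U\<^esub> r, lie Q q s) + frag_of (lie U p r, q \<otimes>\<^bsub>Q\<^esub> s)"
  "scl c (frag_of (p, q)) = frag_of (c \<odot>\<^bsub>U\<^esub> p, q)"
  by (simp_all add: mul_def bra_def scl_def)

lemma G_zero: "0 \<in> G"
  and G_diff: "x \<in> G \<Longrightarrow> y \<in> G \<Longrightarrow> x - y \<in> G"
  and G_add: "x \<in> G \<Longrightarrow> y \<in> G \<Longrightarrow> x + y \<in> G"
  and G_frag_of: "u \<in> carrier U \<Longrightarrow> q \<in> carrier Q \<Longrightarrow> frag_of (u, q) \<in> G"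
  by (simp_all add: G_iff keys_frag_diff_subset keys_frag_add_subset)

lemma G_uminus: "x \<in> G \<Longrightarrow> - x \<in> G"
  using G_diff[OF G_zero] by force

lemma G_closed:
  assumes "x \<in> G" "y \<in> G"
  shows "mul x y \<in> G" "bra x y \<in> G" "c \<in> carrier F \<Longrightarrow> scl c x \<in> G"
proof -
  note intros = G_zero G_diff G_add G_frag_of U.lie_closed Q.lie_closed
    U.mult_closed Q.mult_closed U.smult_closed
  note xy = assms[unfolded G_iff]
  show "mul x y \<in> G"
    by (rule frag_biadditive_in[OF _ _ _ _ _ xy]) (auto simp: additive intro!: intros)
  show "bra x y \<in> G"
    by (rule frag_biadditive_in[OF _ _ _ _ _ xy]) (auto simp: additive intro!: intros)
  show "scl c x \<in> G" if "c \<in> carrier F"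
    by (rule frag_additive_in[OF _ _ _ _ xy(1)]) (auto simp: additive intro!: intros that)
qed

abbreviation rel_gens where
  "rel_gens \<equiv> {frag_of (u \<oplus>\<^bsub>U\<^esub> v, q) - frag_of (u, q) - frag_of (v, q) | u v q.
         u \<in> carrier U \<and> v \<in> carrier U \<and> q \<in> carrier Q} \<union>
      {frag_of (u, q \<oplus>\<^bsub>Q\<^esub> r) - frag_of (u, q) - frag_of (u, r) | u q r.
         u \<in> carrier U \<and> q \<in> carrier Q \<and> r \<in> carrier Q} \<union>
      {frag_of (c \<odot>\<^bsub>U\<^esub> u, q) - frag_of (u, c \<odot>\<^bsub>Q\<^esub> q) | c u q.
         c \<in> carrier F \<and> u \<in> carrier U \<and> q \<in> carrier Q}"

lemma rel_gens_subset: "rel_gens \<subseteq> carrier (tensor_free U Q)"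
  unfolding G_def[symmetric] by (auto intro!: G_diff G_frag_of)

lemma R_subgroup: "subgroup R (tensor_free U Q)"
  unfolding tensor_rel_def tensor_free_def
  by (rule group.generate_is_subgroup[OF group_free_Abelian_group])
    (use rel_gens_subset in \<open>simp add: tensor_free_def\<close>)

lemma R_zero: "0 \<in> R"
  and R_add: "x \<in> R \<Longrightarrow> y \<in> R \<Longrightarrow> x + y \<in> R"
  and R_in_G: "x \<in> R \<Longrightarrow> x \<in> G"
  using subgroup.one_closed[OF R_subgroup] subgroup.m_closed[OF R_subgroup]
    subgroup.mem_carrier[OF R_subgroup]
  by (simp_all add: tensor_free_def G_def)

lemma R_uminus: "x \<in> R \<Longrightarrow> - x \<in> R"
  using subgroup.m_inv_closed[OF R_subgroup, of x] R_in_G[of x]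
  by (simp add: tensor_free_def G_iff)

lemma R_diff: "x \<in> R \<Longrightarrow> y \<in> R \<Longrightarrow> x - y \<in> R"
  using R_add[of x "- y"] R_uminus by simp

lemma R_left: "\<lbrakk>u \<in> carrier U; v \<in> carrier U; q \<in> carrier Q\<rbrakk>
    \<Longrightarrow> frag_of (u \<oplus>\<^bsub>U\<^esub> v, q) - frag_of (u, q) - frag_of (v, q) \<in> R"
  and R_right: "\<lbrakk>u \<in> carrier U; q \<in> carrier Q; r \<in> carrier Q\<rbrakk>
    \<Longrightarrow> frag_of (u, q \<oplus>\<^bsub>Q\<^esub> r) - frag_of (u, q) - frag_of (u, r) \<in> R"
  and R_balanced: "\<lbrakk>c \<in> carrier F; u \<in> carrier U; q \<in> carrier Q\<rbrakk>
    \<Longrightarrow> frag_of (c \<odot>\<^bsub>U\<^esub> u, q) - frag_of (u, c \<odot>\<^bsub>Q\<^esub> q) \<in> R"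
  unfolding tensor_rel_def by (rule generate.incl; blast)+

text \<open>This is how a map out of \<open>U \<otimes> Q\<close> is shown to be well defined: an additive map that sends the three
  kinds of defining relations into a subgroup sends all of \<open>R\<close> there.\<close>

lemma R_induct:
  fixes T :: "('u \<times> 'q \<Rightarrow>\<^sub>0 int) \<Rightarrow> ('b \<Rightarrow>\<^sub>0 int)"
  assumes x: "x \<in> R"
    and T: "\<And>x x'. T (x - x') = T x - T x'"
    and H: "0 \<in> H" "\<And>a b. a \<in> H \<Longrightarrow> b \<in> H \<Longrightarrow> a - b \<in> H"
    and left: "\<And>u v q. \<lbrakk>u \<in> carrier U; v \<in> carrier U; q \<in> carrier Q\<rbrakk>
      \<Longrightarrow> T (frag_of (u \<oplus>\<^bsub>U\<^esub> v, q)) - T (frag_of (u, q)) - T (frag_of (v, q)) \<in> H"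
    and right: "\<And>u q r. \<lbrakk>u \<in> carrier U; q \<in> carrier Q; r \<in> carrier Q\<rbrakk>
      \<Longrightarrow> T (frag_of (u, q \<oplus>\<^bsub>Q\<^esub> r)) - T (frag_of (u, q)) - T (frag_of (u, r)) \<in> H"
    and balanced: "\<And>c u q. \<lbrakk>c \<in> carrier F; u \<in> carrier U; q \<in> carrier Q\<rbrakk>
      \<Longrightarrow> T (frag_of (c \<odot>\<^bsub>U\<^esub> u, q)) - T (frag_of (u, c \<odot>\<^bsub>Q\<^esub> q)) \<in> H"
  shows "T x \<in> H"
proof -
  have T0: "T 0 = 0" using T[of 0 0] by simp
  have Tm: "T (- y) = - T y" for y using T[of 0 y] T0 by simp
  have Ta: "T (y + z) = T y + T z" for y z using T[of y "- z"] Tm by simp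
  have Hm: "- y \<in> H" if "y \<in> H" for y using H(2)[OF H(1) that] by simp
  have Ha: "y + z \<in> H" if "y \<in> H" "z \<in> H" for y z using H(2)[OF that(1) Hm[OF that(2)]] by simp
  have gen: "T h \<in> H" if "h \<in> rel_gens" for h
    using that by (auto simp: T left right balanced)
  show ?thesis
    using x unfolding tensor_rel_def
  proof (induction rule: generate.induct)
    case one
    then show ?case by (simp add: tensor_free_def T0 H)
  next
    case (incl h)
    then show ?case by (rule gen)
  next
    case (inv h)
    have "inv\<^bsub>tensor_free U Q\<^esub> h = - h"
      using subsetD[OF rel_gens_subset inv] by (simp add: tensor_free_def)
    then show ?case using gen[OF inv] by (simp add: Tm Hm)
  next
    case (eng a b)
    then show ?case by (simp add: tensor_free_def Ta Ha)
  qed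
qed

lemma R_zero_left: "q \<in> carrier Q \<Longrightarrow> frag_of (\<zero>\<^bsub>U\<^esub>, q) \<in> R"
  using R_uminus[OF R_left[of "\<zero>\<^bsub>U\<^esub>" "\<zero>\<^bsub>U\<^esub>" q]] by simp

lemma R_zero_right: "u \<in> carrier U \<Longrightarrow> frag_of (u, \<zero>\<^bsub>Q\<^esub>) \<in> R"
  using R_uminus[OF R_right[of u "\<zero>\<^bsub>Q\<^esub>" "\<zero>\<^bsub>Q\<^esub>"]] by simp

lemma R_cancel_left:
  assumes "u \<in> carrier U" "v \<in> carrier U" "q \<in> carrier Q" "u \<oplus>\<^bsub>U\<^esub> v = \<zero>\<^bsub>U\<^esub>"
  shows "frag_of (u, q) + frag_of (v, q) \<in> R"
  using R_diff[OF R_zero_left[of q] R_left[of u v q]] assms by (simp add: algebra_simps)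

lemma R_cancel_right:
  assumes "u \<in> carrier U" "q \<in> carrier Q" "r \<in> carrier Q" "q \<oplus>\<^bsub>Q\<^esub> r = \<zero>\<^bsub>Q\<^esub>"
  shows "frag_of (u, q) + frag_of (u, r) \<in> R"
  using R_diff[OF R_zero_right[of u] R_right[of u q r]] assms by (simp add: algebra_simps)

lemma G_induct_R:
  assumes "x \<in> G" and "\<And>x x'. T (x - x') = T x - T x'"
    and "\<And>u q. u \<in> carrier U \<Longrightarrow> q \<in> carrier Q \<Longrightarrow> T (frag_of (u, q)) \<in> R"
  shows "T x \<in> R"
  using assms
  by - (rule frag_additive_in[where S = "carrier U \<times> carrier Q" and T = T], auto simp: G_iff R_zero R_diff)

lemma G_induct2_R:
  assumes "x \<in> G" "y \<in> G"
    and "\<And>x x' y. T (x - x') y = T x y - T x' y" "\<And>x y y'. T x (y - y') = T x y - T x y'"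
    and "\<And>p q r s. \<lbrakk>p \<in> carrier U; q \<in> carrier Q; r \<in> carrier U; s \<in> carrier Q\<rbrakk>
      \<Longrightarrow> T (frag_of (p, q)) (frag_of (r, s)) \<in> R"
  shows "T x y \<in> R"
  using assms
  by - (rule frag_biadditive_in[where S = "carrier U \<times> carrier Q"
        and S' = "carrier U \<times> carrier Q" and T = T], auto simp: G_iff R_zero R_diff)

lemma G_induct3_R:
  assumes "x \<in> G" "y \<in> G" "z \<in> G"
    and "\<And>x x' y z. T (x - x') y z = T x y z - T x' y z"
    and "\<And>x y y' z. T x (y - y') z = T x y z - T x y' z"
    and "\<And>x y z z'. T x y (z - z') = T x y z - T x y z'"
    and "\<And>p q r s t u. \<lbrakk>p \<in> carrier U; q \<in> carrier Q; r \<in> carrier U; s \<in> carrier Q;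
        t \<in> carrier U; u \<in> carrier Q\<rbrakk>
      \<Longrightarrow> T (frag_of (p, q)) (frag_of (r, s)) (frag_of (t, u)) \<in> R"
  shows "T x y z \<in> R"
  using assms
  by - (rule frag_triadditive_in[where S = "carrier U \<times> carrier Q"
        and S' = "carrier U \<times> carrier Q" and S'' = "carrier U \<times> carrier Q" and T = T], auto simp: G_iff R_zero R_diff)

lemma U_smult_right: "\<lbrakk>c \<in> carrier F; x \<in> carrier U; y \<in> carrier U\<rbrakk>
    \<Longrightarrow> x \<otimes>\<^bsub>U\<^esub> (c \<odot>\<^bsub>U\<^esub> y) = c \<odot>\<^bsub>U\<^esub> (x \<otimes>\<^bsub>U\<^esub> y)"
  by (simp add: U.mult_commute[of x] U.smult_assoc2)

lemma mul_commute: "x \<in> G \<Longrightarrow> y \<in> G \<Longrightarrow> mul x y - mul y x \<in> R"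
  by (rule G_induct2_R[where T = "\<lambda>x y. mul x y - mul y x"])
    (simp_all add: additive algebra_simps U.mult_commute Q.mult_commute R_zero)

text \<open>The two tensors of \<open>[p \<otimes> q, r \<otimes> s]\<close> change sign for different reasons, the first because the
  bracket of \<open>Q\<close> is skew, the second because that of \<open>U\<close> is.\<close>

lemma bra_skew: "x \<in> G \<Longrightarrow> y \<in> G \<Longrightarrow> bra x y + bra y x \<in> R"
proof (rule G_induct2_R[where T = "\<lambda>x y. bra x y + bra y x"])
  fix p q r s assume pr: "p \<in> carrier U" "r \<in> carrier U" and qs: "q \<in> carrier Q" "s \<in> carrier Q"
  have "frag_of (p \<otimes>\<^bsub>U\<^esub> r, lie Q q s) + frag_of (p \<otimes>\<^bsub>U\<^esub> r, lie Q s q) \<in> R"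
    using pr qs by (intro R_cancel_right Q.lie_skew U_closed Q_closed)
  moreover have "frag_of (lie U p r, q \<otimes>\<^bsub>Q\<^esub> s) + frag_of (lie U r p, q \<otimes>\<^bsub>Q\<^esub> s) \<in> R"
    using pr qs by (intro R_cancel_left U.lie_skew U_closed Q_closed)
  ultimately show "bra (frag_of (p, q)) (frag_of (r, s)) + bra (frag_of (r, s)) (frag_of (p, q)) \<in> R"
    using pr qs by (simp add: U.mult_commute[of r p] Q.mult_commute[of s q]) (drule (1) R_add, simp add: algebra_simps)
qed (simp_all add: additive algebra_simps)

text \<open>Being alternating is a quadratic condition and does not follow from the case of generators by
  additivity alone; skew symmetry takes care of the mixed terms.\<close>

lemma bra_alternating:
  assumes "x \<in> G"
  shows "bra x x \<in> R"
proof (rule free_Abelian_group_induct[where P = "\<lambda>x. bra x x \<in> R"])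
  show "Poly_Mapping.keys x \<subseteq> carrier U \<times> carrier Q"
    using assms by (simp add: G_iff)
  show "bra 0 0 \<in> R"
    by (simp add: bra_def frag_bilinear_def R_zero)
next
  fix x y assume *: "Poly_Mapping.keys x \<subseteq> carrier U \<times> carrier Q"
    "Poly_Mapping.keys y \<subseteq> carrier U \<times> carrier Q" "bra x x \<in> R" "bra y y \<in> R"
  have "bra (x - y) (x - y) = bra x x + bra y y - (bra x y + bra y x)"
    by (simp add: additive)
  then show "bra (x - y) (x - y) \<in> R"
    using * bra_skew[of x y] by (simp add: G_iff R_add R_diff)
next
  fix a assume "a \<in> carrier U \<times> carrier Q"
  then show "bra (frag_of a) (frag_of a) \<in> R"
    by (auto simp: U.lie_alternating Q.lie_alternating intro!: R_add R_zero_left R_zero_right U_closed Q_closed)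
qed

text \<open>Multiplying a relation by a pair multiplies it in both components, which gives a relation of the
  same kind.\<close>

lemma mul_R_left:
  assumes x: "x \<in> R" and y: "y \<in> G"
  shows "mul x y \<in> R"
proof (rule G_induct_R[where T = "mul x", OF y])
  fix r s assume rs: "r \<in> carrier U" "s \<in> carrier Q"
  show "mul x (frag_of (r, s)) \<in> R"
  proof (rule R_induct[where T = "\<lambda>x. mul x (frag_of (r, s))", OF x _ R_zero R_diff])
    show "mul (frag_of (u \<oplus>\<^bsub>U\<^esub> v, q)) (frag_of (r, s)) - mul (frag_of (u, q)) (frag_of (r, s))
        - mul (frag_of (v, q)) (frag_of (r, s)) \<in> R"
      if "u \<in> carrier U" "v \<in> carrier U" "q \<in> carrier Q" for u v q
      using that rs by (simp add: U.mult_distrib_left R_left)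
    show "mul (frag_of (u, q \<oplus>\<^bsub>Q\<^esub> r')) (frag_of (r, s)) - mul (frag_of (u, q)) (frag_of (r, s))
        - mul (frag_of (u, r')) (frag_of (r, s)) \<in> R"
      if "u \<in> carrier U" "q \<in> carrier Q" "r' \<in> carrier Q" for u q r'
      using that rs by (simp add: Q.mult_distrib_left R_right)
    show "mul (frag_of (c \<odot>\<^bsub>U\<^esub> u, q)) (frag_of (r, s)) - mul (frag_of (u, c \<odot>\<^bsub>Q\<^esub> q)) (frag_of (r, s)) \<in> R"
      if "c \<in> carrier F" "u \<in> carrier U" "q \<in> carrier Q" for c u q
      using that rs by (simp add: U.smult_assoc2 Q.smult_assoc2 R_balanced)
  qed (simp_all add: additive algebra_simps)
qed (simp_all add: additive algebra_simps)

text \<open>The bracket with a pair has two tensors, and each of them turns a relation into a relation of the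
  same kind; \<open>sum\<close> and \<open>diff\<close> below only regroup the terms.\<close>

lemma bra_R_left:
  assumes x: "x \<in> R" and y: "y \<in> G"
  shows "bra x y \<in> R"
proof (rule G_induct_R[where T = "bra x", OF y])
  fix r s assume rs: "r \<in> carrier U" "s \<in> carrier Q"
  have sum: "(a + b) - (a' + b') - (a'' + b'') \<in> R" if "a - a' - a'' \<in> R" "b - b' - b'' \<in> R"
    for a b a' b' a'' b''
    using R_add[OF that] by (simp add: algebra_simps)
  have diff: "(a + b) - (a' + b') \<in> R" if "a - a' \<in> R" "b - b' \<in> R" for a b a' b'
    using R_add[OF that] by (simp add: algebra_simps)
  show "bra x (frag_of (r, s)) \<in> R"
  proof (rule R_induct[where T = "\<lambda>x. bra x (frag_of (r, s))", OF x _ R_zero R_diff])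
    show "bra (frag_of (u \<oplus>\<^bsub>U\<^esub> v, q)) (frag_of (r, s)) - bra (frag_of (u, q)) (frag_of (r, s))
        - bra (frag_of (v, q)) (frag_of (r, s)) \<in> R"
      if "u \<in> carrier U" "v \<in> carrier U" "q \<in> carrier Q" for u v q
      using that rs unfolding on_generators
      by (simp add: U.mult_distrib_left U.lie_add_left)
         (intro sum R_left U_closed Q_closed)
    show "bra (frag_of (u, q \<oplus>\<^bsub>Q\<^esub> r')) (frag_of (r, s)) - bra (frag_of (u, q)) (frag_of (r, s))
        - bra (frag_of (u, r')) (frag_of (r, s)) \<in> R"
      if "u \<in> carrier U" "q \<in> carrier Q" "r' \<in> carrier Q" for u q r'
      using that rs unfolding on_generators
      by (simp add: Q.mult_distrib_left Q.lie_add_left)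
         (intro sum R_right U_closed Q_closed)
    show "bra (frag_of (c \<odot>\<^bsub>U\<^esub> u, q)) (frag_of (r, s)) - bra (frag_of (u, c \<odot>\<^bsub>Q\<^esub> q)) (frag_of (r, s)) \<in> R"
      if "c \<in> carrier F" "u \<in> carrier U" "q \<in> carrier Q" for c u q
      using that rs unfolding on_generators
      by (simp add: U.smult_assoc2 Q.smult_assoc2 U.lie_smult_left Q.lie_smult_left)
         (intro diff R_balanced U_closed Q_closed)
  qed (simp_all only: additive)
qed (simp_all only: additive)

lemma scl_R:
  assumes c: "c \<in> carrier F" and x: "x \<in> R"
  shows "scl c x \<in> R"
proof (rule R_induct[where T = "scl c", OF x _ R_zero R_diff])
  show "scl c (frag_of (d \<odot>\<^bsub>U\<^esub> u, q)) - scl c (frag_of (u, d \<odot>\<^bsub>Q\<^esub> q)) \<in> R"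
    if "d \<in> carrier F" "u \<in> carrier U" "q \<in> carrier Q" for d u q
    using that c R_balanced[of d "c \<odot>\<^bsub>U\<^esub> u" q] by (simp flip: U.smult_assoc1 add: U.R.m_comm[of c d])
qed (use c in \<open>simp_all add: additive U.smult_r_distr R_left R_right\<close>)

lemma mul_R_right: "x \<in> G \<Longrightarrow> y \<in> R \<Longrightarrow> mul x y \<in> R"
  using R_add[OF mul_commute[of x y] mul_R_left[of y x]] R_in_G[of y] by simp

lemma bra_R_right: "x \<in> G \<Longrightarrow> y \<in> R \<Longrightarrow> bra x y \<in> R"
  using R_diff[OF bra_skew[of x y] bra_R_left[of y x]] R_in_G[of y] by simp

text \<open>These two lemmas make the product and bracket of \<open>U \<otimes> Q\<close> independent of the chosen
  representatives.\<close>

lemma mul_cong: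
  assumes "x \<in> G" "x' \<in> G" "y \<in> G" "y' \<in> G" "x - x' \<in> R" "y - y' \<in> R"
  shows "mul x y - mul x' y' \<in> R"
  using R_add[OF mul_R_left[of "x - x'" y] mul_R_right[of x' "y - y'"]] assms by (simp add: additive)

lemma bra_cong:
  assumes "x \<in> G" "x' \<in> G" "y \<in> G" "y' \<in> G" "x - x' \<in> R" "y - y' \<in> R"
  shows "bra x y - bra x' y' \<in> R"
  using R_add[OF bra_R_left[of "x - x'" y] bra_R_right[of x' "y - y'"]] assms by (simp add: additive)

lemma mul_assoc: "x \<in> G \<Longrightarrow> y \<in> G \<Longrightarrow> z \<in> G \<Longrightarrow> mul (mul x y) z - mul x (mul y z) \<in> R"
  by (rule G_induct3_R[where T = "\<lambda>x y z. mul (mul x y) z - mul x (mul y z)"])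
    (simp_all add: additive algebra_simps U.mult_assoc Q.mult_assoc R_zero)

lemma mul_one: "x \<in> G \<Longrightarrow> mul (frag_of (\<one>\<^bsub>U\<^esub>, \<one>\<^bsub>Q\<^esub>)) x - x \<in> R"
  by (rule G_induct_R[where T = "\<lambda>x. mul (frag_of (\<one>\<^bsub>U\<^esub>, \<one>\<^bsub>Q\<^esub>)) x - x"])
    (simp_all add: additive algebra_simps U.mult_one_left Q.mult_one_left R_zero)

lemma scl_add_scalar:
  "\<lbrakk>c \<in> carrier F; d \<in> carrier F; x \<in> G\<rbrakk> \<Longrightarrow> scl (c \<oplus>\<^bsub>F\<^esub> d) x - (scl c x + scl d x) \<in> R"
  by (rule G_induct_R[where T = "\<lambda>x. scl (c \<oplus>\<^bsub>F\<^esub> d) x - (scl c x + scl d x)"])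
    (simp_all add: additive algebra_simps U.smult_l_distr R_left[simplified algebra_simps])

lemma scl_mult_scalar:
  "\<lbrakk>c \<in> carrier F; d \<in> carrier F; x \<in> G\<rbrakk> \<Longrightarrow> scl (c \<otimes>\<^bsub>F\<^esub> d) x - scl c (scl d x) \<in> R"
  by (rule G_induct_R[where T = "\<lambda>x. scl (c \<otimes>\<^bsub>F\<^esub> d) x - scl c (scl d x)"])
    (simp_all add: additive algebra_simps U.smult_assoc1 R_zero)

lemma scl_one: "x \<in> G \<Longrightarrow> scl \<one>\<^bsub>F\<^esub> x - x \<in> R"
  by (rule G_induct_R[where T = "\<lambda>x. scl \<one>\<^bsub>F\<^esub> x - x"]) (simp_all add: additive algebra_simps R_zero)

lemma mul_scl: "\<lbrakk>c \<in> carrier F; x \<in> G; y \<in> G\<rbrakk> \<Longrightarrow> mul (scl c x) y - scl c (mul x y) \<in> R"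
  by (rule G_induct2_R[where T = "\<lambda>x y. mul (scl c x) y - scl c (mul x y)"])
    (simp_all add: additive algebra_simps U.smult_assoc2 R_zero)

lemma bra_scl_left: "\<lbrakk>c \<in> carrier F; x \<in> G; y \<in> G\<rbrakk> \<Longrightarrow> bra (scl c x) y - scl c (bra x y) \<in> R"
  by (rule G_induct2_R[where T = "\<lambda>x y. bra (scl c x) y - scl c (bra x y)"])
    (simp_all add: additive algebra_simps U.smult_assoc2 U.lie_smult_left R_zero)

lemma bra_scl_right: "\<lbrakk>c \<in> carrier F; x \<in> G; y \<in> G\<rbrakk> \<Longrightarrow> bra x (scl c y) - scl c (bra x y) \<in> R"
  by (rule G_induct2_R[where T = "\<lambda>x y. bra x (scl c y) - scl c (bra x y)"])
    (simp_all add: additive algebra_simps U_smult_right U.lie_smult_right R_zero)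

text \<open>On pairs, the Leibniz rules of \<open>Q\<close> and of \<open>U\<close> apply to one tensor of the bracket each.\<close>

lemma bra_leibniz:
  "x \<in> G \<Longrightarrow> y \<in> G \<Longrightarrow> z \<in> G \<Longrightarrow> bra x (mul y z) - (mul (bra x y) z + mul y (bra x z)) \<in> R"
proof (rule G_induct3_R[where T = "\<lambda>x y z. bra x (mul y z) - (mul (bra x y) z + mul y (bra x z))"])
  fix p q r s t u
  assume U: "p \<in> carrier U" "r \<in> carrier U" "t \<in> carrier U"
    and Q: "q \<in> carrier Q" "s \<in> carrier Q" "u \<in> carrier Q"
  have a: "frag_of (p \<otimes>\<^bsub>U\<^esub> (r \<otimes>\<^bsub>U\<^esub> t), lie Q q (s \<otimes>\<^bsub>Q\<^esub> u))
      - frag_of (p \<otimes>\<^bsub>U\<^esub> (r \<otimes>\<^bsub>U\<^esub> t), lie Q q s \<otimes>\<^bsub>Q\<^esub> u)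
      - frag_of (p \<otimes>\<^bsub>U\<^esub> (r \<otimes>\<^bsub>U\<^esub> t), s \<otimes>\<^bsub>Q\<^esub> lie Q q u) \<in> R"
    unfolding Q.lie_leibniz[OF Q] using U Q by (intro R_right U_closed Q_closed)
  have b: "frag_of (lie U p (r \<otimes>\<^bsub>U\<^esub> t), q \<otimes>\<^bsub>Q\<^esub> (s \<otimes>\<^bsub>Q\<^esub> u))
      - frag_of (lie U p r \<otimes>\<^bsub>U\<^esub> t, q \<otimes>\<^bsub>Q\<^esub> (s \<otimes>\<^bsub>Q\<^esub> u))
      - frag_of (r \<otimes>\<^bsub>U\<^esub> lie U p t, q \<otimes>\<^bsub>Q\<^esub> (s \<otimes>\<^bsub>Q\<^esub> u)) \<in> R"
    unfolding U.lie_leibniz[OF U] using U Q by (intro R_left U_closed Q_closed)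
  have "(frag_of (p \<otimes>\<^bsub>U\<^esub> (r \<otimes>\<^bsub>U\<^esub> t), lie Q q (s \<otimes>\<^bsub>Q\<^esub> u))
      + frag_of (lie U p (r \<otimes>\<^bsub>U\<^esub> t), q \<otimes>\<^bsub>Q\<^esub> (s \<otimes>\<^bsub>Q\<^esub> u)))
      - ((frag_of (p \<otimes>\<^bsub>U\<^esub> (r \<otimes>\<^bsub>U\<^esub> t), lie Q q s \<otimes>\<^bsub>Q\<^esub> u)
        + frag_of (lie U p r \<otimes>\<^bsub>U\<^esub> t, q \<otimes>\<^bsub>Q\<^esub> (s \<otimes>\<^bsub>Q\<^esub> u)))
      + (frag_of (p \<otimes>\<^bsub>U\<^esub> (r \<otimes>\<^bsub>U\<^esub> t), s \<otimes>\<^bsub>Q\<^esub> lie Q q u)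
        + frag_of (r \<otimes>\<^bsub>U\<^esub> lie U p t, q \<otimes>\<^bsub>Q\<^esub> (s \<otimes>\<^bsub>Q\<^esub> u)))) \<in> R"
    using R_add[OF a b] by (simp add: algebra_simps)
  then show "bra (frag_of (p, q)) (mul (frag_of (r, s)) (frag_of (t, u)))
      - (mul (bra (frag_of (p, q)) (frag_of (r, s))) (frag_of (t, u))
         + mul (frag_of (r, s)) (bra (frag_of (p, q)) (frag_of (t, u)))) \<in> R"
    using U Q
    by (simp only: on_generators additive U.mult_assoc Q.mult_assoc U_closed Q_closed U.mult_left_commute[of r p] Q.mult_left_commute[of s q])
qed (simp_all add: additive algebra_simps)

lemma R_cancel3_left:
  assumes "u \<in> carrier U" "v \<in> carrier U" "w \<in> carrier U" "q \<in> carrier Q"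
    and "u \<oplus>\<^bsub>U\<^esub> v \<oplus>\<^bsub>U\<^esub> w = \<zero>\<^bsub>U\<^esub>"
  shows "frag_of (u, q) + frag_of (v, q) + frag_of (w, q) \<in> R"
  using R_diff[OF R_cancel_left[of "u \<oplus>\<^bsub>U\<^esub> v" w q] R_left[of u v q]] assms by (simp add: algebra_simps)

lemma R_cancel3_right:
  assumes "u \<in> carrier U" "q \<in> carrier Q" "r \<in> carrier Q" "s \<in> carrier Q"
    and "q \<oplus>\<^bsub>Q\<^esub> r \<oplus>\<^bsub>Q\<^esub> s = \<zero>\<^bsub>Q\<^esub>"
  shows "frag_of (u, q) + frag_of (u, r) + frag_of (u, s) \<in> R"
  using R_diff[OF R_cancel_right[of u "q \<oplus>\<^bsub>Q\<^esub> r" s] R_right[of u q r]] assms by (simp add: algebra_simps)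

lemma R_skew_left:
  assumes "x \<in> carrier U" "a \<in> carrier U" "b \<in> carrier U" "y \<in> carrier Q"
  shows "frag_of (x \<otimes>\<^bsub>U\<^esub> lie U a b, y) + frag_of (x \<otimes>\<^bsub>U\<^esub> lie U b a, y) \<in> R"
proof (rule R_cancel_left)
  have "x \<otimes>\<^bsub>U\<^esub> lie U a b \<oplus>\<^bsub>U\<^esub> x \<otimes>\<^bsub>U\<^esub> lie U b a = x \<otimes>\<^bsub>U\<^esub> (lie U a b \<oplus>\<^bsub>U\<^esub> lie U b a)"
    using assms by (simp add: U.mult_distrib_right U_closed)
  then show "x \<otimes>\<^bsub>U\<^esub> lie U a b \<oplus>\<^bsub>U\<^esub> x \<otimes>\<^bsub>U\<^esub> lie U b a = \<zero>\<^bsub>U\<^esub>"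
    using assms by (simp add: U.lie_skew U.mult_zero_right)
qed (use assms in \<open>simp_all add: U_closed\<close>)

lemma R_skew_right:
  assumes "x \<in> carrier U" "y \<in> carrier Q" "a \<in> carrier Q" "b \<in> carrier Q"
  shows "frag_of (x, y \<otimes>\<^bsub>Q\<^esub> lie Q a b) + frag_of (x, y \<otimes>\<^bsub>Q\<^esub> lie Q b a) \<in> R"
proof (rule R_cancel_right)
  have "y \<otimes>\<^bsub>Q\<^esub> lie Q a b \<oplus>\<^bsub>Q\<^esub> y \<otimes>\<^bsub>Q\<^esub> lie Q b a = y \<otimes>\<^bsub>Q\<^esub> (lie Q a b \<oplus>\<^bsub>Q\<^esub> lie Q b a)"
    using assms by (simp add: Q.mult_distrib_right Q_closed)
  then show "y \<otimes>\<^bsub>Q\<^esub> lie Q a b \<oplus>\<^bsub>Q\<^esub> y \<otimes>\<^bsub>Q\<^esub> lie Q b a = \<zero>\<^bsub>Q\<^esub>"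
    using assms by (simp add: Q.lie_skew Q.mult_zero_right)
qed (use assms in \<open>simp_all add: Q_closed\<close>)

text \<open>Of the four tensors of \<open>[p \<otimes> q, [r \<otimes> s, t \<otimes> u]]\<close>, two contain a double bracket; the other two
  contain the bracket of an element with a product and are split by the Leibniz rule.\<close>

lemma bra_bra_generators:
  assumes U: "p \<in> carrier U" "r \<in> carrier U" "t \<in> carrier U"
    and Q: "q \<in> carrier Q" "s \<in> carrier Q" "u \<in> carrier Q"
  shows "bra (frag_of (p, q)) (bra (frag_of (r, s)) (frag_of (t, u)))
    - (frag_of (p \<otimes>\<^bsub>U\<^esub> (r \<otimes>\<^bsub>U\<^esub> t), lie Q q (lie Q s u))
       + frag_of (lie U p (lie U r t), q \<otimes>\<^bsub>Q\<^esub> (s \<otimes>\<^bsub>Q\<^esub> u))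
       + (frag_of (t \<otimes>\<^bsub>U\<^esub> lie U p r, q \<otimes>\<^bsub>Q\<^esub> lie Q s u)
          + frag_of (r \<otimes>\<^bsub>U\<^esub> lie U p t, q \<otimes>\<^bsub>Q\<^esub> lie Q s u)
          + frag_of (p \<otimes>\<^bsub>U\<^esub> lie U r t, u \<otimes>\<^bsub>Q\<^esub> lie Q q s)
          + frag_of (p \<otimes>\<^bsub>U\<^esub> lie U r t, s \<otimes>\<^bsub>Q\<^esub> lie Q q u))) \<in> R"
proof -
  have a: "frag_of (lie U p (r \<otimes>\<^bsub>U\<^esub> t), q \<otimes>\<^bsub>Q\<^esub> lie Q s u)
      - frag_of (t \<otimes>\<^bsub>U\<^esub> lie U p r, q \<otimes>\<^bsub>Q\<^esub> lie Q s u)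
      - frag_of (r \<otimes>\<^bsub>U\<^esub> lie U p t, q \<otimes>\<^bsub>Q\<^esub> lie Q s u) \<in> R"
    unfolding U.lie_leibniz[OF U] U.mult_commute[OF U.lie_closed[OF U(1,2)] U(3)]
    using U Q by (intro R_left U_closed Q_closed)
  have b: "frag_of (p \<otimes>\<^bsub>U\<^esub> lie U r t, lie Q q (s \<otimes>\<^bsub>Q\<^esub> u))
      - frag_of (p \<otimes>\<^bsub>U\<^esub> lie U r t, u \<otimes>\<^bsub>Q\<^esub> lie Q q s)
      - frag_of (p \<otimes>\<^bsub>U\<^esub> lie U r t, s \<otimes>\<^bsub>Q\<^esub> lie Q q u) \<in> R"
    unfolding Q.lie_leibniz[OF Q] Q.mult_commute[OF Q.lie_closed[OF Q(1,2)] Q(3)]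
    using U Q by (intro R_right U_closed Q_closed)
  show ?thesis
    using R_add[OF a b] by (simp add: additive algebra_simps)
qed

text \<open>In the cyclic sum of the expansions above, the double brackets cancel by the Jacobi identities of
  \<open>Q\<close> and \<open>U\<close>. The twelve remaining tensors form six pairs that differ in the order of the arguments
  of one bracket; \<open>cancel\<close> records the pairing.\<close>

lemma bra_jacobi:
  "x \<in> G \<Longrightarrow> y \<in> G \<Longrightarrow> z \<in> G \<Longrightarrow> bra x (bra y z) + bra y (bra z x) + bra z (bra x y) \<in> R"
proof (rule G_induct3_R[where T = "\<lambda>x y z. bra x (bra y z) + bra y (bra z x) + bra z (bra x y)"])
  fix p q r s t u
  assume U: "p \<in> carrier U" "r \<in> carrier U" "t \<in> carrier U"
    and Q: "q \<in> carrier Q" "s \<in> carrier Q" "u \<in> carrier Q"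
  have sum: "e1 + e2 + e3 \<in> R"
    if "e1 - (a1 + b1 + k1) \<in> R" "e2 - (a2 + b2 + k2) \<in> R" "e3 - (a3 + b3 + k3) \<in> R"
      "a1 + a2 + a3 \<in> R" "b1 + b2 + b3 \<in> R" "k1 + k2 + k3 \<in> R"
    for e1 e2 e3 a1 a2 a3 b1 b2 b3 k1 k2 k3
    using R_add[OF R_add[OF R_add[OF that(1,2)] that(3)] R_add[OF R_add[OF that(4,5)] that(6)]]
    by (simp add: algebra_simps)
  (* bring the products in the three rotations into the same order *)
  have cyc: "r \<otimes>\<^bsub>U\<^esub> (t \<otimes>\<^bsub>U\<^esub> p) = p \<otimes>\<^bsub>U\<^esub> (r \<otimes>\<^bsub>U\<^esub> t)" "t \<otimes>\<^bsub>U\<^esub> (p \<otimes>\<^bsub>U\<^esub> r) = p \<otimes>\<^bsub>U\<^esub> (r \<otimes>\<^bsub>U\<^esub> t)"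
    "s \<otimes>\<^bsub>Q\<^esub> (u \<otimes>\<^bsub>Q\<^esub> q) = q \<otimes>\<^bsub>Q\<^esub> (s \<otimes>\<^bsub>Q\<^esub> u)" "u \<otimes>\<^bsub>Q\<^esub> (q \<otimes>\<^bsub>Q\<^esub> s) = q \<otimes>\<^bsub>Q\<^esub> (s \<otimes>\<^bsub>Q\<^esub> u)"
    using U Q by (simp_all add: U.mult_commute U.mult_left_commute Q.mult_commute Q.mult_left_commute U_closed Q_closed)
  have cancel: "(a + b + c + d) + (d' + e + b' + f) + (f' + c' + e' + a') \<in> R"
    if "a + a' \<in> R" "b + b' \<in> R" "c + c' \<in> R" "d + d' \<in> R" "e + e' \<in> R" "f + f' \<in> R"
    for a a' b b' c c' d d' e e' f f'
    using R_add[OF R_add[OF R_add[OF that(1,2)] R_add[OF that(3,4)]] R_add[OF that(5,6)]]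
    by (simp add: algebra_simps)
  show "bra (frag_of (p, q)) (bra (frag_of (r, s)) (frag_of (t, u)))
      + bra (frag_of (r, s)) (bra (frag_of (t, u)) (frag_of (p, q)))
      + bra (frag_of (t, u)) (bra (frag_of (p, q)) (frag_of (r, s))) \<in> R"
    by (rule sum[OF bra_bra_generators bra_bra_generators bra_bra_generators],
        (rule U Q)+, unfold cyc)
      (intro cancel R_cancel3_left R_cancel3_right R_skew_left R_skew_right U.lie_jacobi Q.lie_jacobi
        U_closed Q_closed U Q)+
qed (simp_all add: additive algebra_simps)

end

section \<open>Presentations of the tensor product\<close>

text \<open>A surjection \<open>c\<close> from the formal combinations onto \<open>P\<close> with kernel \<open>R\<close> that carries the lifted
  operations to those of \<open>P\<close>: in other words \<open>P\<close> is a copy of \<open>U \<otimes> Q\<close>, and \<open>c\<close> the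
  quotient map.\<close>

locale tensor_presentation = poisson_pair F U Q
  for F :: "'k ring" and U :: "('k, 'u) poisson" and Q :: "('k, 'q) poisson" +
  fixes c :: "('u \<times> 'q \<Rightarrow>\<^sub>0 int) \<Rightarrow> 'p" and P :: "('k, 'p) poisson"
  assumes carrier_eq: "carrier P = c ` G"
    and eq_iff: "\<lbrakk>x \<in> G; y \<in> G\<rbrakk> \<Longrightarrow> c x = c y \<longleftrightarrow> x - y \<in> R"
    and mult_eq: "\<lbrakk>x \<in> G; y \<in> G\<rbrakk> \<Longrightarrow> c x \<otimes>\<^bsub>P\<^esub> c y = c (mul x y)"
    and one_eq: "\<one>\<^bsub>P\<^esub> = c (frag_of (\<one>\<^bsub>U\<^esub>, \<one>\<^bsub>Q\<^esub>))"
    and zero_eq: "\<zero>\<^bsub>P\<^esub> = c 0"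
    and add_eq: "\<lbrakk>x \<in> G; y \<in> G\<rbrakk> \<Longrightarrow> c x \<oplus>\<^bsub>P\<^esub> c y = c (x + y)"
    and smult_eq: "\<lbrakk>k \<in> carrier F; x \<in> G\<rbrakk> \<Longrightarrow> k \<odot>\<^bsub>P\<^esub> c x = c (scl k x)"
    and lie_eq: "\<lbrakk>x \<in> G; y \<in> G\<rbrakk> \<Longrightarrow> lie P (c x) (c y) = c (bra x y)"
begin

text \<open>Every axiom is the image under \<open>c\<close> of a congruence modulo \<open>R\<close> between formal combinations.\<close>

lemma poisson_algebra: "poisson_algebra F P"
proof -
  have one: "frag_of (\<one>\<^bsub>U\<^esub>, \<one>\<^bsub>Q\<^esub>) \<in> G"
    by (simp add: G_frag_of)
  note G_intros = G_closed G_zero G_add G_diff G_uminus one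
  note ops = mult_eq one_eq zero_eq add_eq smult_eq lie_eq G_intros
  have cI: "c x = c y" if "x - y \<in> R" "x \<in> G" "y \<in> G" for x y
    using that by (simp add: eq_iff)
  have abelian: "abelian_group P"
  proof (rule abelian_groupI; (unfold carrier_eq)?)
    show "\<exists>y\<in>c ` G. y \<oplus>\<^bsub>P\<^esub> x = \<zero>\<^bsub>P\<^esub>" if "x \<in> c ` G" for x
    proof -
      from that obtain a where a: "x = c a" "a \<in> G" by auto
      then have "c (- a) \<oplus>\<^bsub>P\<^esub> x = \<zero>\<^bsub>P\<^esub>" by (simp add: ops)
      then show ?thesis using a by (auto intro: G_intros)
    qed
  qed (auto simp: ops algebra_simps)
  have comm: "comm_monoid P"
    by (rule comm_monoidI; (unfold carrier_eq)?)
      (auto simp: ops intro!: cI mul_assoc mul_one mul_commute G_intros)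
  have cring: "cring P"
  proof (rule cringI[OF abelian comm]; (unfold carrier_eq)?)
  qed (auto simp: ops additive)
  have alg: "algebra F P"
  proof (rule algebraI[OF U.R_cring cring]; (unfold carrier_eq)?)
  qed (auto simp: ops additive intro!: cI scl_add_scalar scl_mult_scalar scl_one mul_scl G_intros
      U.R.m_closed U.R.a_closed)
  show ?thesis
  proof (intro poisson_algebra.intro alg poisson_algebra_axioms.intro; (unfold carrier_eq)?)
  qed (auto simp: ops additive intro!: cI bra_scl_left bra_scl_right bra_leibniz G_intros
      arg_cong[of _ _ c] simp: eq_iff bra_alternating bra_jacobi)
qed

end

context poisson_pair
begin

lemma tensor_class_eq_iff:
  assumes "x \<in> G" "y \<in> G"
  shows "tensor_class F U Q x = tensor_class F U Q y \<longleftrightarrow> x - y \<in> R"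
proof -
  have cls: "tensor_class F U Q x = {h + x |h. h \<in> R}" for x
    by (auto simp: tensor_class_def r_coset_def tensor_free_def)
  show ?thesis
  proof
    assume "tensor_class F U Q x = tensor_class F U Q y"
    moreover have "x \<in> tensor_class F U Q x"
      unfolding cls using R_zero by force
    ultimately show "x - y \<in> R"
      unfolding cls by auto
  next
    assume xy: "x - y \<in> R"
    have "h + x \<in> {h + y |h. h \<in> R}" "h + y \<in> {h + x |h. h \<in> R}" if "h \<in> R" for h
      using R_add[OF that xy] R_diff[OF that xy] by (auto simp: algebra_simps intro: exI[of _ "h + (x - y)"] exI[of _ "h - (x - y)"])
    then show "tensor_class F U Q x = tensor_class F U Q y"
      unfolding cls by blast
  qed
qed

lemma some_rep_tensor_class:
  assumes "x \<in> G"
  shows "some_rep (tensor_class F U Q x) \<in> G" "some_rep (tensor_class F U Q x) - x \<in> R"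
proof -
  have "x \<in> tensor_class F U Q x"
    using R_zero by (force simp: tensor_class_def r_coset_def tensor_free_def)
  then have "some_rep (tensor_class F U Q x) \<in> tensor_class F U Q x"
    unfolding some_rep_def by (rule someI)
  then obtain h where h: "h \<in> R" "some_rep (tensor_class F U Q x) = h + x"
    by (auto simp: tensor_class_def r_coset_def tensor_free_def)
  show "some_rep (tensor_class F U Q x) \<in> G" "some_rep (tensor_class F U Q x) - x \<in> R"
    unfolding h(2) using h(1) assms by (simp_all add: G_add R_in_G)
qed

lemma tensor_presentation_poisson_tensor:
  "tensor_presentation F U Q (tensor_class F U Q) (poisson_tensor F U Q)"
proof
  have R_normal: "R \<lhd> tensor_free U Q"
    using R_subgroup abelian_free_Abelian_group[of "carrier U \<times> carrier Q"]
    by (simp add: tensor_free_def comm_group.normal_iff_subgroup)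
  show "carrier (poisson_tensor F U Q) = tensor_class F U Q ` G"
    by (auto simp: poisson_tensor_def FactGroup_def RCOSETS_def tensor_class_def G_def)
  show "tensor_class F U Q x = tensor_class F U Q y \<longleftrightarrow> x - y \<in> R" if "x \<in> G" "y \<in> G" for x y
    using that by (rule tensor_class_eq_iff)
  show "\<one>\<^bsub>poisson_tensor F U Q\<^esub> = tensor_class F U Q (frag_of (\<one>\<^bsub>U\<^esub>, \<one>\<^bsub>Q\<^esub>))"
    by (simp add: poisson_tensor_def)
  show "\<zero>\<^bsub>poisson_tensor F U Q\<^esub> = tensor_class F U Q 0"
    by (simp add: poisson_tensor_def FactGroup_def tensor_class_def r_coset_def tensor_free_def)
  fix x y assume x: "x \<in> G" and y: "y \<in> G"
  note reps = some_rep_tensor_class[OF x] some_rep_tensor_class[OF y]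
  show "tensor_class F U Q x \<oplus>\<^bsub>poisson_tensor F U Q\<^esub> tensor_class F U Q y = tensor_class F U Q (x + y)"
    using normal.rcos_sum[OF R_normal, of x y] x y
    by (simp add: poisson_tensor_def FactGroup_def tensor_class_def G_def) (simp add: tensor_free_def)
  show "tensor_class F U Q x \<otimes>\<^bsub>poisson_tensor F U Q\<^esub> tensor_class F U Q y = tensor_class F U Q (mul x y)"
    unfolding poisson_tensor_def using x y reps
    by (simp add: tensor_class_eq_iff mul_cong G_closed flip: mul_def)
  show "lie (poisson_tensor F U Q) (tensor_class F U Q x) (tensor_class F U Q y) = tensor_class F U Q (bra x y)"
    unfolding poisson_tensor_def using x y reps
    by (simp add: tensor_class_eq_iff bra_cong G_closed flip: bra_def)
next
  fix k x assume k: "k \<in> carrier F" and x: "x \<in> G"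
  note reps = some_rep_tensor_class[OF x]
  show "k \<odot>\<^bsub>poisson_tensor F U Q\<^esub> tensor_class F U Q x = tensor_class F U Q (scl k x)"
    unfolding poisson_tensor_def using k x reps scl_R[OF k reps(2)]
    by (simp add: tensor_class_eq_iff G_closed additive flip: scl_def)
qed

end

lemma (in tensor_presentation) tensor_presentation_transport:
  assumes h: "inj_on h (carrier P)"
  shows "tensor_presentation F U Q (h \<circ> c) (transport h P)"
proof -
  have inv: "inv_into (carrier P) h (h (c x)) = c x" if "x \<in> G" for x
    using that by (intro inv_into_f_f h) (simp add: carrier_eq)
  have inj: "h (c x) = h (c y) \<longleftrightarrow> x - y \<in> R" if "x \<in> G" "y \<in> G" for x y
    using inj_on_eq_iff[OF h, of "c x" "c y"] that by (simp add: carrier_eq eq_iff)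
  show ?thesis
  proof
    show "carrier (transport h P) = (h \<circ> c) ` G"
      by (simp add: transport_def Let_def carrier_eq image_comp)
  qed (simp_all add: transport_def Let_def inv inj mult_eq one_eq zero_eq add_eq smult_eq lie_eq)
qed

section \<open>The tensor product fits into an infinite universe\<close>

context poisson_pair
begin

text \<open>Moving the scalars across the tensor sign leaves one tensor for each element of the spanning set.\<close>

lemma frag_of_lincomb:
  assumes A: "finite A" "A \<subseteq> carrier U" and a: "a \<in> A \<rightarrow> carrier F" and q: "q \<in> carrier Q"
  shows "frag_of (U.lincomb a A, q) - (\<Sum>e\<in>A. frag_of (e, a e \<odot>\<^bsub>Q\<^esub> q)) \<in> R"
  using A a
proof (induction A rule: finite_induct)
  case empty
  then show ?case using q by (simp add: U.lincomb_def R_zero_left)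
next
  case (insert e A)
  have e: "e \<in> carrier U" "a e \<in> carrier F" and Aa: "(\<lambda>v. a v \<odot>\<^bsub>U\<^esub> v) \<in> A \<rightarrow> carrier U"
    using insert.prems by auto
  have "U.lincomb a (insert e A) = a e \<odot>\<^bsub>U\<^esub> e \<oplus>\<^bsub>U\<^esub> U.lincomb a A"
    unfolding U.lincomb_def using insert.hyps e Aa by (intro U.M.finsum_insert) auto
  moreover have "U.lincomb a A \<in> carrier U"
    unfolding U.lincomb_def using Aa by (rule U.M.finsum_closed)
  ultimately show ?case
    using R_add[OF R_add[OF R_left[of "a e \<odot>\<^bsub>U\<^esub> e" "U.lincomb a A" q] R_balanced[of "a e" e q]] insert.IH]
      insert.hyps insert.prems e q
    by (simp add: algebra_simps)
qed

lemma generator_expansion: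
  assumes A: "finite A" "A \<subseteq> carrier U" "U.span A = carrier U" and x: "x \<in> G"
  shows "\<exists>f \<in> A \<rightarrow> carrier Q. x - (\<Sum>e\<in>A. frag_of (e, f e)) \<in> R"
proof (rule free_Abelian_group_induct[where P = "\<lambda>x. \<exists>f \<in> A \<rightarrow> carrier Q. x - (\<Sum>e\<in>A. frag_of (e, f e)) \<in> R"])
  show "Poly_Mapping.keys x \<subseteq> carrier U \<times> carrier Q"
    using x by (simp add: G_iff)
next
  have "(\<Sum>e\<in>A. frag_of (e, \<zero>\<^bsub>Q\<^esub>)) \<in> R"
    using A(1,2) by (induction A rule: finite_induct) (auto simp: R_zero R_add R_zero_right)
  then show "\<exists>f \<in> A \<rightarrow> carrier Q. 0 - (\<Sum>e\<in>A. frag_of (e, f e)) \<in> R"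
    by (intro bexI[of _ "\<lambda>_. \<zero>\<^bsub>Q\<^esub>"]) (auto simp: R_uminus)
next
  fix x y assume "\<exists>f \<in> A \<rightarrow> carrier Q. x - (\<Sum>e\<in>A. frag_of (e, f e)) \<in> R"
    "\<exists>f \<in> A \<rightarrow> carrier Q. y - (\<Sum>e\<in>A. frag_of (e, f e)) \<in> R"
  then obtain f g where f: "f \<in> A \<rightarrow> carrier Q" "x - (\<Sum>e\<in>A. frag_of (e, f e)) \<in> R"
    and g: "g \<in> A \<rightarrow> carrier Q" "y - (\<Sum>e\<in>A. frag_of (e, g e)) \<in> R"
    by auto
  have one: "frag_of (e, f e) - frag_of (e, g e) - frag_of (e, f e \<ominus>\<^bsub>Q\<^esub> g e) \<in> R" if "e \<in> A" for e
  proof -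
    have mem: "e \<in> carrier U" "f e \<in> carrier Q" "g e \<in> carrier Q"
      using that A f g by auto
    then have "g e \<oplus>\<^bsub>Q\<^esub> (f e \<ominus>\<^bsub>Q\<^esub> g e) = f e"
      by (simp add: a_minus_def Q.M.add.m_lcomm Q.M.r_neg)
    then show ?thesis
      using R_right[of e "g e" "f e \<ominus>\<^bsub>Q\<^esub> g e"] mem by simp
  qed
  have "(\<Sum>e\<in>A. frag_of (e, f e) - frag_of (e, g e) - frag_of (e, f e \<ominus>\<^bsub>Q\<^esub> g e)) \<in> R"
    using A(1) one by (induction A rule: finite_induct) (auto simp: R_zero R_add)
  then have "(\<Sum>e\<in>A. frag_of (e, f e)) - (\<Sum>e\<in>A. frag_of (e, g e))
      - (\<Sum>e\<in>A. frag_of (e, f e \<ominus>\<^bsub>Q\<^esub> g e)) \<in> R"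
    by (simp add: sum_subtractf)
  then have "x - y - (\<Sum>e\<in>A. frag_of (e, f e \<ominus>\<^bsub>Q\<^esub> g e)) \<in> R"
    using R_add[OF R_diff[OF f(2) g(2)], of "(\<Sum>e\<in>A. frag_of (e, f e)) - (\<Sum>e\<in>A. frag_of (e, g e))
      - (\<Sum>e\<in>A. frag_of (e, f e \<ominus>\<^bsub>Q\<^esub> g e))"] by (simp add: algebra_simps)
  then show "\<exists>f \<in> A \<rightarrow> carrier Q. x - y - (\<Sum>e\<in>A. frag_of (e, f e)) \<in> R"
    using f g by (intro bexI[of _ "\<lambda>e. f e \<ominus>\<^bsub>Q\<^esub> g e"]) auto
next
  fix s assume "s \<in> carrier U \<times> carrier Q"
  then obtain u q where s: "s = (u, q)" "u \<in> carrier U" "q \<in> carrier Q" by auto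
  have "u \<in> {U.lincomb a A |a. a \<in> A \<rightarrow> carrier F}"
    using s(2) A(3) U.finite_span[OF A(1,2)] by simp
  then obtain a where a: "a \<in> A \<rightarrow> carrier F" "u = U.lincomb a A" by auto
  show "\<exists>f \<in> A \<rightarrow> carrier Q. frag_of s - (\<Sum>e\<in>A. frag_of (e, f e)) \<in> R"
    using frag_of_lincomb[OF A(1,2) a(1) s(3)] s a
    by (intro bexI[of _ "\<lambda>e. a e \<odot>\<^bsub>Q\<^esub> q"]) auto
qed

end

text \<open>Enumerating the spanning set \<open>A\<close> turns the coefficient functions \<open>A \<rightarrow> Q\<close> of
  \<open>generator_expansion\<close> into lists, and the lists over an infinite set inject into that
  set. This is uniform in \<open>Q\<close>, finite or infinite.\<close>

lemma ex_inj_tensor: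
  fixes F :: "'k ring" and U :: "('k, 'u) poisson" and Q :: "('k, 'a) poisson"
  assumes inf: "infinite (UNIV :: 'a set)" and F: "field F"
    and U: "poisson_algebra F U" and fin_dim: "vectorspace.fin_dim F U" and Q: "poisson_algebra F Q"
  shows "\<exists>h :: ('u \<times> 'a \<Rightarrow>\<^sub>0 int) set \<Rightarrow> 'a. inj_on h (carrier (poisson_tensor F U Q))"
proof -
  interpret poisson_pair F U Q
    by (intro poisson_pair.intro U Q)
  interpret T: tensor_presentation F U Q "tensor_class F U Q" "poisson_tensor F U Q"
    by (rule tensor_presentation_poisson_tensor)
  have "vectorspace F U"
    by (intro vectorspace.intro U.module F)
  then obtain A where A: "finite A" "A \<subseteq> carrier U" "U.span A = carrier U"
    using fin_dim by (auto simp: vectorspace.fin_dim_def)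
  obtain i where i: "bij_betw i A {0..<card A}"
    using ex_bij_betw_finite_nat[OF A(1)] by blast
  define \<phi> :: "'a list \<Rightarrow> ('u \<times> 'a \<Rightarrow>\<^sub>0 int) set"
    where "\<phi> l = tensor_class F U Q (\<Sum>e\<in>A. frag_of (e, l ! i e))" for l
  have "carrier (poisson_tensor F U Q) \<subseteq> range \<phi>"
  proof
    fix y assume "y \<in> carrier (poisson_tensor F U Q)"
    then obtain x where x: "x \<in> G" "y = tensor_class F U Q x"
      by (auto simp: T.carrier_eq)
    from generator_expansion[OF A x(1)] obtain f
      where f: "f \<in> A \<rightarrow> carrier Q" "x - (\<Sum>e\<in>A. frag_of (e, f e)) \<in> R" by auto
    define l where "l = map (f \<circ> inv_into A i) [0..<card A]"
    have l: "l ! i e = f e" if "e \<in> A" for e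
      using bij_betwE[OF i] bij_betw_inv_into_left[OF i] that by (simp add: l_def)
    have "(\<Sum>e\<in>A. frag_of (e, f e)) \<in> G"
      using G_diff[OF x(1) R_in_G[OF f(2)]] by simp
    then have "y = tensor_class F U Q (\<Sum>e\<in>A. frag_of (e, f e))"
      using x f by (simp add: tensor_class_eq_iff)
    also have "\<dots> = \<phi> l"
      unfolding \<phi>_def using l by (intro arg_cong[where f = "tensor_class F U Q"] sum.cong) auto
    finally show "y \<in> range \<phi>" by blast
  qed
  then have "inj_on (inv_into UNIV \<phi>) (carrier (poisson_tensor F U Q))"
    by (rule inj_on_inv_into)
  moreover obtain j :: "'a list \<Rightarrow> 'a" where "inj j"
    using card_of_lists_infinite[OF inf] by (auto simp: card_of_ordIso[symmetric] bij_betw_def)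
  ultimately have "inj_on (j \<circ> inv_into UNIV \<phi>) (carrier (poisson_tensor F U Q))"
    by (intro comp_inj_on) (auto intro: inj_on_subset)
  then show ?thesis by blast
qed

section \<open>The tensor functor\<close>

lemma poisson_homD:
  assumes "h \<in> poisson_hom F P Q"
  shows "h \<in> extensional (carrier P)" "h \<in> carrier P \<rightarrow> carrier Q"
    and "\<lbrakk>x \<in> carrier P; y \<in> carrier P\<rbrakk> \<Longrightarrow> h (x \<oplus>\<^bsub>P\<^esub> y) = h x \<oplus>\<^bsub>Q\<^esub> h y"
    and "\<lbrakk>x \<in> carrier P; y \<in> carrier P\<rbrakk> \<Longrightarrow> h (x \<otimes>\<^bsub>P\<^esub> y) = h x \<otimes>\<^bsub>Q\<^esub> h y"
    and "h \<one>\<^bsub>P\<^esub> = \<one>\<^bsub>Q\<^esub>"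
    and "\<lbrakk>c \<in> carrier F; x \<in> carrier P\<rbrakk> \<Longrightarrow> h (c \<odot>\<^bsub>P\<^esub> x) = c \<odot>\<^bsub>Q\<^esub> h x"
    and "\<lbrakk>x \<in> carrier P; y \<in> carrier P\<rbrakk> \<Longrightarrow> h (lie P x y) = lie Q (h x) (h y)"
  using assms by (auto simp: poisson_hom_def module_hom_def ring_hom_def)

lemma poisson_homI:
  assumes "h \<in> extensional (carrier P)" "\<And>x. x \<in> carrier P \<Longrightarrow> h x \<in> carrier Q"
    and "\<And>x y. \<lbrakk>x \<in> carrier P; y \<in> carrier P\<rbrakk> \<Longrightarrow> h (x \<oplus>\<^bsub>P\<^esub> y) = h x \<oplus>\<^bsub>Q\<^esub> h y"
    and "\<And>x y. \<lbrakk>x \<in> carrier P; y \<in> carrier P\<rbrakk> \<Longrightarrow> h (x \<otimes>\<^bsub>P\<^esub> y) = h x \<otimes>\<^bsub>Q\<^esub> h y"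
    and "h \<one>\<^bsub>P\<^esub> = \<one>\<^bsub>Q\<^esub>"
    and "\<And>c x. \<lbrakk>c \<in> carrier F; x \<in> carrier P\<rbrakk> \<Longrightarrow> h (c \<odot>\<^bsub>P\<^esub> x) = c \<odot>\<^bsub>Q\<^esub> h x"
    and "\<And>x y. \<lbrakk>x \<in> carrier P; y \<in> carrier P\<rbrakk> \<Longrightarrow> h (lie P x y) = lie Q (h x) (h y)"
  shows "h \<in> poisson_hom F P Q"
  using assms by (auto simp: poisson_hom_def module_hom_def ring_hom_def)

lemma poisson_hom_compose:
  assumes f: "f \<in> poisson_hom F X Y" and g: "g \<in> poisson_hom F Y Z" and X: "poisson_algebra F X"
  shows "compose (carrier X) g f \<in> poisson_hom F X Z"
proof -
  interpret X: poisson_algebra F X by (rule X)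
  have m: "f x \<in> carrier Y" if "x \<in> carrier X" for x
    using poisson_homD(2)[OF f] that by auto
  have "g y \<in> carrier Z" if "y \<in> carrier Y" for y
    using poisson_homD(2)[OF g] that by auto
  then show ?thesis
    using m by (intro poisson_homI)
      (auto simp: compose_eq poisson_homD(3-)[OF f] poisson_homD(3-)[OF g] X.lie_closed)
qed

lemma category_Poiss: "category (Poiss F :: (('k, 'a) poisson, 'a \<Rightarrow> 'a) cat)"
proof
  fix X :: "('k, 'a) poisson" assume X: "X \<in> Ob (Poiss F)"
  then interpret poisson_algebra F X by (simp add: Poiss_def)
  show "Idt (Poiss F) X \<in> Hom (Poiss F) X X"
    by (auto simp: Poiss_def lie_closed intro!: poisson_homI)
qed (auto simp: Poiss_def poisson_hom_compose intro!: compose_assoc[OF poisson_homD(2), symmetric]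
    Id_compose[OF poisson_homD(2,1)] compose_Id[OF poisson_homD(2,1)])

text \<open>The lift of \<open>id \<otimes> g\<close> to representatives.\<close>

definition id_frag :: "('q \<Rightarrow> 'q) \<Rightarrow> ('u \<times> 'q \<Rightarrow>\<^sub>0 int) \<Rightarrow> ('u \<times> 'q \<Rightarrow>\<^sub>0 int)" where
  "id_frag g = frag_extend (\<lambda>(u, q). frag_of (u, g q))"

lemma id_frag_of [simp]: "id_frag g (frag_of (u, q)) = frag_of (u, g q)"
  by (simp add: id_frag_def)

lemma id_frag_additive:
  "id_frag g 0 = 0" "id_frag g (x - y) = id_frag g x - id_frag g y"
  "id_frag g (x + y) = id_frag g x + id_frag g y"
  by (simp_all add: id_frag_def frag_extend_diff frag_extend_add)

locale poisson_pair_hom = A: poisson_pair F U Q + B: poisson_pair F U Q'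
  for F :: "'k ring" and U :: "('k, 'u) poisson" and Q :: "('k, 'q) poisson" and Q' :: "('k, 'q) poisson" +
  fixes g :: "'q \<Rightarrow> 'q"
  assumes g: "g \<in> poisson_hom F Q Q'"
begin

lemma g_closed: "q \<in> carrier Q \<Longrightarrow> g q \<in> carrier Q'"
  using poisson_homD(2)[OF g] by auto

lemma id_frag_closed:
  assumes "x \<in> A.G" shows "id_frag g x \<in> B.G"
  using assms unfolding A.G_iff
  by (rule frag_additive_in[where T = "id_frag g", rotated -1])
    (auto simp: id_frag_additive B.G_zero B.G_diff g_closed intro!: B.G_frag_of)

lemma id_frag_R:
  assumes "x \<in> A.R" shows "id_frag g x \<in> B.R"
  using assms
  by (rule A.R_induct[where T = "id_frag g"])
    (auto simp: id_frag_additive B.R_zero B.R_diff g_closed poisson_homD(3-)[OF g]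
      intro!: B.R_left B.R_right B.R_balanced)

lemma id_frag_mul:
  assumes "x \<in> A.G" "y \<in> A.G"
  shows "id_frag g (A.mul x y) = B.mul (id_frag g x) (id_frag g y)"
proof -
  have "id_frag g (A.mul x y) - B.mul (id_frag g x) (id_frag g y) \<in> {0}"
    by (rule frag_biadditive_in[where T = "\<lambda>x y. id_frag g (A.mul x y) - B.mul (id_frag g x) (id_frag g y)",
          OF _ _ _ _ _ assms[unfolded A.G_iff]])
      (auto simp: id_frag_additive A.additive B.additive poisson_homD(3-)[OF g])
  then show ?thesis by simp
qed

lemma id_frag_bra:
  assumes "x \<in> A.G" "y \<in> A.G"
  shows "id_frag g (A.bra x y) = B.bra (id_frag g x) (id_frag g y)"
proof -
  have "id_frag g (A.bra x y) - B.bra (id_frag g x) (id_frag g y) \<in> {0}"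
    by (rule frag_biadditive_in[where T = "\<lambda>x y. id_frag g (A.bra x y) - B.bra (id_frag g x) (id_frag g y)",
          OF _ _ _ _ _ assms[unfolded A.G_iff]])
      (auto simp: id_frag_additive A.additive B.additive poisson_homD(3-)[OF g])
  then show ?thesis by simp
qed

lemma id_frag_scl:
  assumes "x \<in> A.G"
  shows "id_frag g (A.scl k x) = B.scl k (id_frag g x)"
proof -
  have "id_frag g (A.scl k x) - B.scl k (id_frag g x) \<in> {0}"
    by (rule frag_additive_in[where T = "\<lambda>x. id_frag g (A.scl k x) - B.scl k (id_frag g x)",
          OF _ _ _ _ assms[unfolded A.G_iff]])
      (auto simp: id_frag_additive A.additive B.additive)
  then show ?thesis by simp
qed

lemma id_tensor_class:
  assumes "x \<in> A.G"
  shows "id_tensor F U Q' g (tensor_class F U Q x) = tensor_class F U Q' (id_frag g x)"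
  using A.some_rep_tensor_class[OF assms] id_frag_R[of "some_rep (tensor_class F U Q x) - x"] assms
  by (simp add: id_tensor_def B.tensor_class_eq_iff id_frag_closed id_frag_additive flip: id_frag_def)

text \<open>The lift of \<open>id \<otimes> g\<close> commutes with the lifted operations on the nose, so any map that it
  induces between copies of the two tensor products is a morphism.\<close>

lemma poisson_hom_of_presentations:
  assumes c: "tensor_presentation F U Q c P" and c': "tensor_presentation F U Q' c' P'"
    and t: "t \<in> extensional (carrier P)" "\<And>x. x \<in> A.G \<Longrightarrow> t (c x) = c' (id_frag g x)"
  shows "t \<in> poisson_hom F P P'"
proof -
  interpret P: tensor_presentation F U Q c P by (rule c)
  interpret P': tensor_presentation F U Q' c' P' by (rule c')
  show ?thesis
  proof (rule poisson_homI[OF t(1)]; (unfold P.carrier_eq P'.carrier_eq)?)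
    have "frag_of (\<one>\<^bsub>U\<^esub>, \<one>\<^bsub>Q\<^esub>) \<in> A.G" by (simp add: A.G_frag_of)
    then show "t \<one>\<^bsub>P\<^esub> = \<one>\<^bsub>P'\<^esub>"
      by (simp add: P.one_eq P'.one_eq t(2) poisson_homD(5)[OF g])
  qed (auto simp: t(2) id_frag_closed A.G_add A.G_closed P.mult_eq P'.mult_eq P.add_eq P'.add_eq
      P.smult_eq P'.smult_eq P.lie_eq P'.lie_eq id_frag_mul id_frag_bra id_frag_scl id_frag_additive)
qed

end

text \<open>The type argument fixes the universe \<open>'a\<close>, which occurs in neither \<open>F\<close> nor \<open>U\<close>.\<close>

locale tensor_functor =
  fixes F :: "'k ring" and U :: "('k, 'u) poisson" and univ :: "'a itself"
  assumes infinite_universe: "infinite (UNIV :: 'a set)"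
    and field: "field F"
    and U: "poisson_algebra F U"
    and fin_dim: "vectorspace.fin_dim F U"
begin

text \<open>The quotient map onto the copy of \<open>U \<otimes> Q\<close> inside the universe.\<close>

definition tensor_point :: "('k, 'a) poisson \<Rightarrow> ('u \<times> 'a \<Rightarrow>\<^sub>0 int) \<Rightarrow> 'a" where
  "tensor_point Q = tensor_enc F U Q \<circ> tensor_class F U Q"

lemma pair: "poisson_algebra F Q \<Longrightarrow> poisson_pair F U Q"
  by (intro poisson_pair.intro U)

lemma tensor_enc_inj:
  fixes Q :: "('k, 'a) poisson"
  assumes "poisson_algebra F Q"
  shows "inj_on (tensor_enc F U Q) (carrier (poisson_tensor F U Q))"
  unfolding tensor_enc_def
  by (rule someI_ex[OF ex_inj_tensor[OF infinite_universe field U fin_dim assms]])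

lemma tensor_obj_presentation:
  fixes Q :: "('k, 'a) poisson"
  assumes "poisson_algebra F Q"
  shows "tensor_presentation F U Q (tensor_point Q) (tensor_obj F U Q)"
  unfolding tensor_obj_def tensor_point_def
  by (intro tensor_presentation.tensor_presentation_transport
      poisson_pair.tensor_presentation_poisson_tensor pair tensor_enc_inj assms)

lemma tensor_arr_point:
  fixes Q Q' :: "('k, 'a) poisson"
  assumes Q: "poisson_algebra F Q" and Q': "poisson_algebra F Q'" and g: "g \<in> poisson_hom F Q Q'"
    and x: "x \<in> poisson_pair.G U Q"
  shows "tensor_arr F U Q Q' g (tensor_point Q x) = tensor_point Q' (id_frag g x)"
proof -
  interpret poisson_pair_hom F U Q Q' g
    by (intro poisson_pair_hom.intro pair Q Q' poisson_pair_hom_axioms.intro g)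
  interpret T: tensor_presentation F U Q "tensor_class F U Q" "poisson_tensor F U Q"
    by (rule A.tensor_presentation_poisson_tensor)
  interpret O: tensor_presentation F U Q "tensor_point Q" "tensor_obj F U Q"
    by (rule tensor_obj_presentation[OF Q])
  have "tensor_point Q x \<in> carrier (tensor_obj F U Q)"
    using x unfolding O.carrier_eq by (rule imageI)
  moreover have "inv_into (carrier (poisson_tensor F U Q)) (tensor_enc F U Q) (tensor_point Q x) = tensor_class F U Q x"
    using tensor_enc_inj[OF Q] x by (simp add: tensor_point_def T.carrier_eq)
  ultimately show ?thesis
    using x by (simp add: tensor_arr_def id_tensor_class) (simp add: tensor_point_def)
qed

lemma tensor_obj_poisson: "poisson_algebra F (Q :: ('k, 'a) poisson) \<Longrightarrow> poisson_algebra F (tensor_obj F U Q)"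
  by (rule tensor_presentation.poisson_algebra[OF tensor_obj_presentation])

lemma carrier_tensor_obj:
  "poisson_algebra F (Q :: ('k, 'a) poisson) \<Longrightarrow> carrier (tensor_obj F U Q) = tensor_point Q ` poisson_pair.G U Q"
  by (rule tensor_presentation.carrier_eq[OF tensor_obj_presentation])

lemma tensor_arr_hom:
  fixes Q Q' :: "('k, 'a) poisson"
  assumes Q: "poisson_algebra F Q" and Q': "poisson_algebra F Q'" and g: "g \<in> poisson_hom F Q Q'"
  shows "tensor_arr F U Q Q' g \<in> poisson_hom F (tensor_obj F U Q) (tensor_obj F U Q')"
proof (rule poisson_pair_hom.poisson_hom_of_presentations)
  show "poisson_pair_hom F U Q Q' g"
    by (intro poisson_pair_hom.intro pair Q Q' poisson_pair_hom_axioms.intro g)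
  show "tensor_presentation F U Q (tensor_point Q) (tensor_obj F U Q)"
    "tensor_presentation F U Q' (tensor_point Q') (tensor_obj F U Q')"
    by (intro tensor_obj_presentation Q Q')+
  show "tensor_arr F U Q Q' g \<in> extensional (carrier (tensor_obj F U Q))"
    by (simp add: tensor_arr_def)
qed (rule tensor_arr_point[OF Q Q' g])

lemma tensor_arr_id:
  fixes Q :: "('k, 'a) poisson"
  assumes Q: "poisson_algebra F Q"
  shows "tensor_arr F U Q Q (\<lambda>x\<in>carrier Q. x) = (\<lambda>x\<in>carrier (tensor_obj F U Q). x)"
proof (rule extensionalityI[where A = "carrier (tensor_obj F U Q)"])
  interpret poisson_pair F U Q by (rule pair[OF Q])
  have id: "(\<lambda>x\<in>carrier Q. x) \<in> poisson_hom F Q Q"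
    using category.id_hom[OF category_Poiss, of Q F] Q by (simp add: Poiss_def)
  fix x assume x: "x \<in> carrier (tensor_obj F U Q)"
  then obtain a where a: "a \<in> G" "x = tensor_point Q a"
    by (auto simp: carrier_tensor_obj[OF Q])
  have "id_frag (\<lambda>x\<in>carrier Q. x) a = frag_extend frag_of a"
    unfolding id_frag_def using a(1) by (intro frag_extend_eq) (auto simp: G_iff)
  then show "tensor_arr F U Q Q (\<lambda>x\<in>carrier Q. x) x = (\<lambda>x\<in>carrier (tensor_obj F U Q). x) x"
    using x a tensor_arr_point[OF Q Q id a(1)] by (simp flip: frag_expansion)
qed (simp_all add: tensor_arr_def)

lemma tensor_arr_compose:
  fixes X Y Z :: "('k, 'a) poisson"
  assumes X: "poisson_algebra F X" and Y: "poisson_algebra F Y" and Z: "poisson_algebra F Z"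
    and f: "f \<in> poisson_hom F X Y" and g: "g \<in> poisson_hom F Y Z"
  shows "tensor_arr F U X Z (compose (carrier X) g f)
    = compose (carrier (tensor_obj F U X)) (tensor_arr F U Y Z g) (tensor_arr F U X Y f)"
proof (rule extensionalityI[where A = "carrier (tensor_obj F U X)"])
  interpret f: poisson_pair_hom F U X Y f
    by (intro poisson_pair_hom.intro pair X Y poisson_pair_hom_axioms.intro f)
  fix x assume x: "x \<in> carrier (tensor_obj F U X)"
  then obtain a where a: "a \<in> f.A.G" "x = tensor_point X a"
    by (auto simp: carrier_tensor_obj[OF X])
  have "id_frag (compose (carrier X) g f) a - id_frag g (id_frag f a) \<in> {0}"
    by (rule frag_additive_in[where T = "\<lambda>a. id_frag (compose (carrier X) g f) a - id_frag g (id_frag f a)",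
          OF _ _ _ _ a(1)[unfolded f.A.G_iff]])
      (auto simp: id_frag_additive compose_eq)
  then show "tensor_arr F U X Z (compose (carrier X) g f) x
      = compose (carrier (tensor_obj F U X)) (tensor_arr F U Y Z g) (tensor_arr F U X Y f) x"
    using x tensor_arr_point[OF X Z poisson_hom_compose[OF f g X] a(1)] tensor_arr_point[OF X Y f a(1)]
      tensor_arr_point[OF Y Z g f.id_frag_closed[OF a(1)]] unfolding a(2) by (simp add: compose_eq)
qed (simp_all add: tensor_arr_def)

lemma cat_functor_tensor:
  "cat_functor (Poiss F) (Poiss F) (tensor_obj F U :: ('k, 'a) poisson \<Rightarrow> _) (tensor_arr F U)"
  by (intro cat_functor.intro category_Poiss cat_functor_axioms.intro)
    (auto simp: Poiss_def tensor_obj_poisson tensor_arr_hom tensor_arr_id tensor_arr_compose)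

end

section \<open>The adjunction\<close>

theorem theorem3p5:
  fixes F :: "'k ring"
    and U :: "('k, 'u) poisson"
    and B :: "('k, 'a) poisson \<Rightarrow> ('k, 'a) poisson"
    and \<psi> :: "('k, 'a) poisson \<Rightarrow> 'a \<Rightarrow> 'a"
  assumes "infinite (UNIV :: 'a set)"
    and "field F"
    and "poisson_algebra F U"
    and "vectorspace.fin_dim F U"
    and "\<And>X. poisson_algebra F X \<Longrightarrow> is_universal_poisson F U X (B X) (\<psi> X)"
  shows "left_adjoint (Poiss F) (Poiss F) B (L_arr F U B \<psi>) (tensor_obj F U) (tensor_arr F U)"
proof -
  interpret tensor_functor F U "TYPE('a)"
    by (intro tensor_functor.intro assms(1-4))
  have B: "poisson_algebra F (B X)" and \<psi>: "\<psi> X \<in> poisson_hom F X (tensor_obj F U (B X))"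
    and universal: "\<lbrakk>poisson_algebra F Q; f \<in> poisson_hom F X (tensor_obj F U Q)\<rbrakk> \<Longrightarrow>
      \<exists>!g. g \<in> poisson_hom F (B X) Q \<and> compose (carrier X) (tensor_arr F U (B X) Q g) (\<psi> X) = f"
    if "poisson_algebra F X" for X Q :: "('k, 'a) poisson" and f
    using assms(5)[OF that] by (auto simp: is_universal_poisson_def)
  show ?thesis
  proof (rule left_adjoint_of_universal_arrows[where \<eta> = \<psi>, OF category_Poiss cat_functor_tensor])
    fix X Y :: "('k, 'a) poisson" and f assume "X \<in> Ob (Poiss F)" "Y \<in> Ob (Poiss F)" "f \<in> Hom (Poiss F) X Y"
    then have X: "poisson_algebra F X" and Y: "poisson_algebra F Y" and f: "f \<in> poisson_hom F X Y"
      by (simp_all add: Poiss_def)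
    have "\<exists>!g. g \<in> poisson_hom F (B X) (B Y) \<and>
        compose (carrier X) (tensor_arr F U (B X) (B Y) g) (\<psi> X) = compose (carrier X) (\<psi> Y) f"
      by (intro universal X B Y poisson_hom_compose[OF f \<psi>])
    (* the description defining L_arr is the factorisation of \<open>\<psi> Y \<circ> f\<close> through \<open>\<psi> X\<close> *)
    from theI'[OF this, folded L_arr_def]
    show "L_arr F U B \<psi> X Y f \<in> Hom (Poiss F) (B X) (B Y) \<and>
        Cmp (Poiss F) X (tensor_obj F U (B X)) (tensor_obj F U (B Y))
          (tensor_arr F U (B X) (B Y) (L_arr F U B \<psi> X Y f)) (\<psi> X)
        = Cmp (Poiss F) X Y (tensor_obj F U (B Y)) (\<psi> Y) f"
      by (simp add: Poiss_def)
  qed (auto simp: Poiss_def B \<psi> universal)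
qed

end
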